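(* Fix $R>0$. For each $n$ let $K_n$ be a positive integer and $0=t_0<t_1<\dots<t_{K_n}=1$ (possibly depending on $n$). Let $g$ be a fixed Lebesgue density on $\mathbb{R}$ that is positive and $\beta$-Hölder continuous for some $0<\beta\le1$, and consider the prior on $\mathbf{a}\in\mathbb{R}^{K_n}$ with Lebesgue density $\pi(\mathbf{a})=\prod_{j=1}^{K_n}g(a_j)$, with $\mathbf{a}$ parametrizing $f=\sum_{j=1}^{K_n}a_j\mathbf{1}_{[t_{j-1},t_j)}$. Assume $$n\,\frac{\inf_{j=1,\dots,K_n}|t_j-t_{j-1}|}{K_n^{1/\beta}\log(K_n)}\to\infty.$$ Denote by $\Pi(\vartheta\in\cdot\mid N)$ the marginal posterior of $\vartheta:=\int_0^1 f$. If $K_n\to\infty$, then $$\sup_{f_0\in \mathrm{PC}^*(K_n,(t_0,\dots,t_{K_n}),R)}E_{f_0}\Big[\Big\|\Pi(\vartheta\in\cdot\mid N)-\mathcal{N}\Big(\widehat\vartheta^{\mathrm{MLE}}-\frac{K_n}{n},\frac{K_n}{n^2}\Big)\Big\|_{\mathrm{TV}}\Big]\to0.$$ Moreover, for $0<\alpha<1$ the interval $$I(\alpha)=\Big[\widehat\vartheta^{\mathrm{MLE}}-\frac{K_n}{n}+\frac{\sqrt{K_n}}{n}\Phi^{-1}(\alpha/2),\ \widehat\vartheta^{\mathrm{MLE}}-\frac{K_n}{n}+\frac{\sqrt{K_n}}{n}\Phi^{-1}(1-\alpha/2)\Big]$$ is an asymptotic $(1-\alpha)$-credible interval and is an honest asymptotic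 confidence set: $$\sup_{f_0\in \mathrm{PC}^*(K_n,(t_0,\dots,t_{K_n}),R)}\Big|P_{f_0}\Big(\int_0^1 f_0\in I(\alpha)\Big)-(1-\alpha)\Big|\to0.$$
   Context: Model: $P_f$ (expectation $E_f$) is the law of a Poisson point process $N=\sum_i\delta_{(X_i,Y_i)}$ on $[0,1]\times\mathbb{R}$ with intensity $n\mathbf{1}(f(x)\le y)$ with respect to Lebesgue measure. $\mathrm{PC}^*(K,(t_0,\dots,t_K),R)=\{f=\sum_{j=1}^K a_j\mathbf{1}_{[t_{j-1},t_j)}:|a_j|\le R\}$. With $f_{\mathbf{a}}=\sum_j a_j\mathbf{1}_{[t_{j-1},t_j)}$, the posterior on $\mathbb{R}^{K_n}$ is $$\Pi(B\mid N)=\frac{\int_B e^{n\int_0^1 f_{\mathbf{a}}}\mathbf{1}(\forall i:f_{\mathbf{a}}(X_i)\le Y_i)\prod_j g(a_j)\,d\mathbf{a}}{\int_{\mathbb{R}^{K_n}}e^{n\int_0^1 f_{\mathbf{a}}}\mathbf{1}(\forall i:f_{\mathbf{a}}(X_i)\le Y_i)\prod_jg(a_j)\,d\mathbf{a}}.$$ The MLE is $\widehat f^{\mathrm{MLE}}=\sum_{j=1}^{K_n}\widehat a_j\mathbf{1}_{[t_{j-1},t_j)}$ with $\widehat a_j=\min_{i:X_i\in[t_{j-1},t_j)}Y_i$, and $\widehat\vartheta^{\mathrm{MLE}}=\int_0^1\widehat f^{\mathrm{MLE}}$. $\Phi$ is the standard normal distribution function; $\mathcal{N}(\mu,\sigma^2)$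 has mean $\mu$ and variance $\sigma^2$. $\|P-Q\|_{\mathrm{TV}}=\sup_B|P(B)-Q(B)|$. "Asymptotic $(1-\alpha)$-credible interval" means that its posterior probability $\Pi(\vartheta\in I(\alpha)\mid N)$ satisfies $E_{f_0}[\Pi(\vartheta\in I(\alpha)\mid N)]\to1-\alpha$ (uniformly over the class of $f_0$). *)

theory Defs
  imports "HOL-Probability.Probability"
begin

text \<open>A point process with infinitely many points is given by an enumeration
  \<open>Z 0, Z 1, \<dots>\<close> of its points, so that \<open>N = (\<Sum>i. \<delta>\<^sub>Z\<^sub>i)\<close>; the following is \<open>N(B)\<close>.\<close>

definition point_count :: "(nat \<Rightarrow> 'a) \<Rightarrow> 'a set \<Rightarrow> ennreal" where
  "point_count z B = emeasure (count_space UNIV) {i. z i \<in> B}"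

text \<open>Being a Poisson point process with intensity measure \<open>\<mu>\<close> is a property of \<open>N\<close> alone, not of the
  enumeration. Since all indices in \<open>nat\<close> carry a point, this notion is only satisfiable
  for intensity measures of infinite total mass. The first clause forces every point to lie in
  \<open>space \<mu>\<close>. In the second clause \<open>0 ^ 0 = 1\<close> takes care of null sets.\<close>

definition poisson_point_process :: "'w measure \<Rightarrow> (nat \<Rightarrow> 'w \<Rightarrow> 'a) \<Rightarrow> 'a measure \<Rightarrow> bool" where
  "poisson_point_process M Z \<mu> \<longleftrightarrow>
     prob_space M \<and> (\<forall>i. Z i \<in> measurable M \<mu>) \<and>
     (\<forall>B\<in>sets \<mu>. emeasure \<mu> B < \<infinity> \<longrightarrow>
        (\<forall>k::nat. measure M {\<omega>\<in>space M. point_count (\<lambda>i. Z i \<omega>) B = of_nat k}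
            = exp (- measure \<mu> B) * measure \<mu> B ^ k / fact k)) \<and>
     (\<forall>B\<in>sets \<mu>. emeasure \<mu> B = \<infinity> \<longrightarrow> (AE \<omega> in M. point_count (\<lambda>i. Z i \<omega>) B = \<infinity>)) \<and>
     (\<forall>(m::nat) B. B ` {..<m} \<subseteq> sets \<mu> \<and> disjoint_family_on B {..<m} \<longrightarrow>
        prob_space.indep_vars M (\<lambda>_. borel) (\<lambda>j \<omega>. point_count (\<lambda>i. Z i \<omega>) (B j)) {..<m})"

definition intensity :: "nat \<Rightarrow> (real \<Rightarrow> real) \<Rightarrow> (real \<times> real) measure" where
  "intensity n f =
     density (restrict_space lborel ({0..1} \<times> UNIV)) (\<lambda>(x, y). ennreal (of_nat n * of_bool (f x \<le> y)))"

text \<open>Only the values \<open>a 1, \<dots>, a K\<close> matter; the \<open>K\<close>-dimensional parameter space is represented by the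
  product space over the index set \<open>{1..K}\<close>.\<close>

definition step_fun :: "nat \<Rightarrow> (nat \<Rightarrow> real) \<Rightarrow> (nat \<Rightarrow> real) \<Rightarrow> real \<Rightarrow> real" where
  "step_fun K t a = (\<lambda>x. \<Sum>j=1..K. a j * indicator {t (j - 1)..<t j} x)"

definition PC_star :: "nat \<Rightarrow> (nat \<Rightarrow> real) \<Rightarrow> real \<Rightarrow> (real \<Rightarrow> real) set" where
  "PC_star K t R = {step_fun K t a | a. \<forall>j\<in>{1..K}. \<bar>a j\<bar> \<le> R}"

definition theta :: "(real \<Rightarrow> real) \<Rightarrow> real" where
  "theta f = (LBINT x:{0..1}. f x)"

abbreviation param_space :: "nat \<Rightarrow> (nat \<Rightarrow> real) measure" where
  "param_space K \<equiv> Pi\<^sub>M {1..K} (\<lambda>_. lborel)"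

definition post_weight ::
  "nat \<Rightarrow> nat \<Rightarrow> (nat \<Rightarrow> real) \<Rightarrow> (real \<Rightarrow> real) \<Rightarrow> (nat \<Rightarrow> real \<times> real) \<Rightarrow> (nat \<Rightarrow> real) \<Rightarrow> real" where
  "post_weight n K t g z a =
     exp (of_nat n * theta (step_fun K t a))
     * of_bool (\<forall>i. step_fun K t a (fst (z i)) \<le> snd (z i))
     * (\<Prod>j=1..K. g (a j))"

definition posterior ::
  "nat \<Rightarrow> nat \<Rightarrow> (nat \<Rightarrow> real) \<Rightarrow> (real \<Rightarrow> real) \<Rightarrow> (nat \<Rightarrow> real \<times> real) \<Rightarrow> (nat \<Rightarrow> real) measure" where
  "posterior n K t g z = density (param_space K)
     (\<lambda>a. ennreal (post_weight n K t g z a) / (\<integral>\<^sup>+a. ennreal (post_weight n K t g z a) \<partial>param_space K))"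

text \<open>The posterior measure is indeed the quotient of integrals in Bayes' formula.\<close>

lemma theta_step_fun:
  "theta (step_fun K t a) = (\<Sum>j=1..K. a j * (LBINT x:{0..1}. indicator {t (j - 1)..<t j} x))"
proof -
  have int: "integrable lborel (\<lambda>x. indicator {0..1} x *\<^sub>R (a j * indicator {t (j - 1)..<t j} x) :: real)" for j
  proof -
    have "integrable lborel (\<lambda>x. indicator ({0..1} \<inter> {t (j - 1)..<t j}) x * a j :: real)"
      by (intro integrable_mult_left integrable_real_indicator)
        (auto intro: le_less_trans[OF emeasure_mono[of _ "{0..1::real}"]])
    then show ?thesis
      by (simp add: indicator_inter_arith mult_ac)
  qed
  show ?thesis
    unfolding theta_def step_fun_def set_lebesgue_integral_def scaleR_sum_right
    by (subst Bochner_Integration.integral_sum[OF int])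
      (simp add: mult.left_commute flip: integral_mult_right_zero)
qed

lemma measurable_post_weight:
  assumes [measurable]: "g \<in> borel_measurable borel"
  shows "post_weight n K t g z \<in> borel_measurable (param_space K)"
proof -
  have [measurable]: "(\<lambda>a. step_fun K t a x) \<in> borel_measurable (param_space K)" for x
    unfolding step_fun_def by measurable
  have [measurable]: "(\<lambda>a. theta (step_fun K t a)) \<in> borel_measurable (param_space K)"
    unfolding theta_step_fun by measurable
  show ?thesis
    unfolding post_weight_def by measurable
qed

lemma emeasure_posterior:
  assumes "g \<in> borel_measurable borel" and B: "B \<in> sets (param_space K)"
  shows "emeasure (posterior n K t g z) B =
    (\<integral>\<^sup>+a\<in>B. ennreal (post_weight n K t g z a) \<partial>param_space K)
      / (\<integral>\<^sup>+a. ennreal (post_weight n K t g z a) \<partial>param_space K)"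
proof -
  let ?w = "\<lambda>a. ennreal (post_weight n K t g z a)"
  note [measurable] = measurable_post_weight[OF assms(1)] B
  have "emeasure (posterior n K t g z) B
      = (\<integral>\<^sup>+a. ?w a / (\<integral>\<^sup>+a. ?w a \<partial>param_space K) * indicator B a \<partial>param_space K)"
    unfolding posterior_def by (rule emeasure_density) measurable
  also have "\<dots> = (\<integral>\<^sup>+a. ?w a * indicator B a / (\<integral>\<^sup>+a. ?w a \<partial>param_space K) \<partial>param_space K)"
    by (intro nn_integral_cong) (simp add: divide_ennreal_def mult_ac)
  also have "\<dots> = (\<integral>\<^sup>+a\<in>B. ?w a \<partial>param_space K) / (\<integral>\<^sup>+a. ?w a \<partial>param_space K)"
    by (rule nn_integral_divide) measurable
  finally show ?thesis .
qed

definition marginal_posterior ::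
  "nat \<Rightarrow> nat \<Rightarrow> (nat \<Rightarrow> real) \<Rightarrow> (real \<Rightarrow> real) \<Rightarrow> (nat \<Rightarrow> real \<times> real) \<Rightarrow> real measure" where
  "marginal_posterior n K t g z = distr (posterior n K t g z) borel (\<lambda>a. theta (step_fun K t a))"

text \<open>The minimum of the infinite set \<open>{Y\<^sub>i | X\<^sub>i \<in> [t\<^sub>j\<^sub>-\<^sub>1, t\<^sub>j)}\<close>; it exists almost surely, because
  almost surely this set is nonempty and only finitely many of its points lie below any given level.\<close>

definition mle_coeff :: "(nat \<Rightarrow> real) \<Rightarrow> (nat \<Rightarrow> real \<times> real) \<Rightarrow> nat \<Rightarrow> real" where
  "mle_coeff t z j = (LEAST y. \<exists>i. fst (z i) \<in> {t (j - 1)..<t j} \<and> snd (z i) = y)"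

definition theta_mle :: "nat \<Rightarrow> (nat \<Rightarrow> real) \<Rightarrow> (nat \<Rightarrow> real \<times> real) \<Rightarrow> real" where
  "theta_mle K t z = theta (step_fun K t (mle_coeff t z))"

definition normal_law :: "real \<Rightarrow> real \<Rightarrow> real measure" where
  "normal_law \<mu> v = density lborel (normal_density \<mu> (sqrt v))"

definition tv_dist :: "real measure \<Rightarrow> real measure \<Rightarrow> real" where
  "tv_dist P Q = (SUP B\<in>sets borel. \<bar>measure P B - measure Q B\<bar>)"

definition std_normal_cdf :: "real \<Rightarrow> real" where
  "std_normal_cdf = cdf std_normal_distribution"

definition credible_interval ::
  "nat \<Rightarrow> nat \<Rightarrow> (nat \<Rightarrow> real) \<Rightarrow> real \<Rightarrow> (nat \<Rightarrow> real \<times> real) \<Rightarrow> real set" where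
  "credible_interval n K t \<alpha> z =
     {theta_mle K t z - real K / real n + sqrt (real K) / real n * inv std_normal_cdf (\<alpha> / 2) ..
      theta_mle K t z - real K / real n + sqrt (real K) / real n * inv std_normal_cdf (1 - \<alpha> / 2)}"

definition positive_holder_density :: "real \<Rightarrow> (real \<Rightarrow> real) \<Rightarrow> bool" where
  "positive_holder_density \<beta> g \<longleftrightarrow>
     g \<in> borel_measurable borel \<and> (\<integral>\<^sup>+x. ennreal (g x) \<partial>lborel) = 1 \<and> (\<forall>x. 0 < g x) \<and>
     (\<exists>C. \<forall>x y. \<bar>g x - g y\<bar> \<le> C * \<bar>x - y\<bar> powr \<beta>)"

end

theory Submission
  imports Defs "HOL-Real_Asymp.Real_Asymp"
begin

text \<open>On the cell \<open>j\<close> put \<open>m\<^sub>j = n (t\<^sub>j - t\<^sub>j\<^sub>-\<^sub>1)\<close>, and let \<open>\<^bold>a\<close> denote the vector of the MLE coefficients.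
  In the coordinates \<open>b\<^sub>j = m\<^sub>j (\<^bold>a\<^sub>j - a\<^sub>j)\<close> the posterior density is proportional to
  \<open>\<Prod>\<^sub>j exp (- b\<^sub>j) g (a\<^sub>j) / g (\<^bold>a\<^sub>j)\<close> on \<open>b\<^sub>j \<ge> 0\<close>. By Hoelder continuity each ratio deviates from \<open>1\<close> by
  \<open>O(m\<^sub>j powr - \<beta>)\<close> in the mean under the exponential law, as long as \<open>\<^bold>a\<^sub>j\<close> stays in a fixed compact set,
  and \<open>\<bar>\<Prod>\<^sub>j r\<^sub>j - 1\<bar> \<le> \<Prod>\<^sub>j (1 + \<bar>r\<^sub>j - 1\<bar>) - 1\<close> turns this into a total variation bound of order \<open>K (n h) powr - \<beta>\<close>
  for the whole product, where \<open>h\<close> is the smallest width. All \<open>\<^bold>a\<^sub>j\<close> stay in the compact set up to probability \<open>K exp (- n h)\<close>.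
  Both errors vanish under the assumption on the grid.

  So \<open>n (\<vartheta>\<^sup>M\<^sup>L\<^sup>E - \<vartheta>)\<close> is approximately Gamma distributed with shape \<open>K\<close> under the posterior. The same law describes
  \<open>n (\<vartheta>\<^sup>M\<^sup>L\<^sup>E - \<vartheta>\<^sub>0)\<close> exactly under the sampling distribution, since the \<open>m\<^sub>j (\<^bold>a\<^sub>j - a\<^sub>0\<^sub>j)\<close> are independent standard
  exponential variables. Finally the Gamma law is close to \<open>N(K, K)\<close> in total variation: the standardised densities without
  their normalising constants converge pointwise and are dominated by a multiple of \<open>exp (- \<bar>u\<bar> / 4)\<close>, so the constants
  converge as well and Stirling's formula is not needed.\<close>

section \<open>Normal approximation of the Gamma law\<close>

lemma power_pred_eq_exp_ln:
  fixes y :: real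
  assumes "0 < y" "1 \<le> K"
  shows "y ^ (K - 1) = exp ((real K - 1) * ln y)"
proof -
  have "exp (real (K - 1) * ln y) = y ^ (K - 1)"
    using assms by (simp only: exp_of_nat_mult exp_ln)
  then show ?thesis using assms by (simp add: of_nat_diff)
qed

text \<open>For \<open>1 \<le> K\<close>, the density of \<open>(G - K) / sqrt K\<close> with
  \<open>G\<close> a Gamma variable of shape \<open>K\<close>, divided by its value at
  \<open>u = 0\<close>. The division removes the factorial.\<close>

definition scaled_gamma :: "nat \<Rightarrow> real \<Rightarrow> real" where
  "scaled_gamma K u = (if - sqrt K < u then (1 + u / sqrt K) ^ (K - 1) * exp (- sqrt K * u) else 0)"

lemma borel_measurable_scaled_gamma [measurable]: "scaled_gamma K \<in> borel_measurable borel"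
  unfolding scaled_gamma_def by measurable

lemma scaled_gamma_nonneg: "0 \<le> scaled_gamma K u"
proof (cases "- sqrt K < u")
  case True
  then have "0 \<le> 1 + u / sqrt K" by (cases "K = 0") (simp_all add: field_simps)
  then show ?thesis by (simp add: scaled_gamma_def)
qed (simp add: scaled_gamma_def)

text \<open>The exponent decays quadratically for small \<open>u\<close> and linearly for large
  \<open>u\<close>. The substitution \<open>y = sqrt (1 + x) - 1\<close> covers both regimes at
  once, since \<open>y\<close> behaves like \<open>x / 2\<close> near 0 and like
  \<open>sqrt x\<close> at infinity, and \<open>ln (1 + x) - x \<le> - y^2\<close> holds
  throughout.\<close>

lemma scaled_gamma_le:
  assumes "2 \<le> K"
  shows "scaled_gamma K u \<le> exp (5 / 4 - \<bar>u\<bar> / 4)"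
proof (cases "- sqrt K < u")
  case True
  define x y v where "x = u / sqrt K" and "y = sqrt (1 + x) - 1" and "v = sqrt K * \<bar>y\<bar>"
  have K: "1 \<le> sqrt K" using assms by simp
  have x: "-1 < x" and u: "u = sqrt K * x"
    using True K by (simp_all add: x_def less_divide_eq)
  have y: "-1 < y" "x = y * (y + 2)"
    using x real_sqrt_mult_self[of "1 + x"] by (simp_all add: y_def algebra_simps)
  have "ln (1 + x) = 2 * ln (sqrt (1 + x))"
    using x by (simp add: ln_sqrt)
  also have "\<dots> \<le> 2 * y"
    using x ln_le_minus_one[of "sqrt (1 + x)"] by (simp add: y_def)
  finally have ln: "ln (1 + x) - x \<le> - y\<^sup>2"
    using y by (simp add: algebra_simps power2_eq_square)
  have "\<bar>u\<bar> = sqrt K * (\<bar>y\<bar> * (y + 2))"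
    using y by (simp add: u abs_mult)
  also have "\<dots> \<le> sqrt K * (\<bar>y\<bar> * (sqrt K * \<bar>y\<bar> + 2))"
  proof -
    have "\<bar>y\<bar> \<le> sqrt K * \<bar>y\<bar>" using K by (simp add: mult_le_cancel_right1)
    then show ?thesis using K by (intro mult_left_mono add_mono) auto
  qed
  also have "\<dots> = v\<^sup>2 + 2 * v" by (simp add: v_def power2_eq_square algebra_simps)
  finally have uv: "\<bar>u\<bar> \<le> v\<^sup>2 + 2 * v" .
  have v2: "v\<^sup>2 = K * y\<^sup>2" by (simp add: v_def power_mult_distrib)
  \<comment> \<open>There are \<open>K - 1\<close> logarithms against \<open>K\<close> linear terms;
    the surplus term \<open>- x\<close> is at most 1.\<close>
  have "(real K - 1) * ln (1 + x) - K * x = (real K - 1) * (ln (1 + x) - x) - x"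
    by (simp add: algebra_simps)
  also have "\<dots> \<le> (real K - 1) * (- y\<^sup>2) + 1"
    using x assms ln by (intro add_mono[of _ _ "- x", simplified] mult_left_mono) auto
  \<comment> \<open>This is the place where \<open>2 \<le> K\<close> enters, through
    \<open>K / 2 \<le> K - 1\<close>.\<close>
  also have "\<dots> \<le> 1 - v\<^sup>2 / 2"
  proof -
    have "real K / 2 * y\<^sup>2 \<le> (real K - 1) * y\<^sup>2" using assms by (intro mult_right_mono) auto
    then show ?thesis by (simp add: v2 algebra_simps)
  qed
  \<comment> \<open>After inserting \<open>uv\<close>, the gap between the two sides is at least
    \<open>(v - 1)^2 / 4\<close>; this fixes the constants \<open>5 / 4\<close> and
    \<open>1 / 4\<close>.\<close>
  also have "\<dots> \<le> 5 / 4 - \<bar>u\<bar> / 4"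
    using uv zero_le_power2[of "v - 1"] by (simp add: power2_eq_square algebra_simps)
  finally have le: "(real K - 1) * ln (1 + x) - K * x \<le> 5 / 4 - \<bar>u\<bar> / 4" .
  have "(1 + x) ^ (K - 1) = exp ((real K - 1) * ln (1 + x))"
    using x assms by (intro power_pred_eq_exp_ln) auto
  moreover have "sqrt K * u = K * x" using u by simp
  ultimately have "scaled_gamma K u = exp ((real K - 1) * ln (1 + x) - K * x)"
    using True by (simp add: scaled_gamma_def x_def exp_diff exp_minus divide_inverse)
  then show ?thesis using le by simp
qed (simp add: scaled_gamma_def)

text \<open>In the second-order expansion of \<open>ln (1 + u / sqrt K)\<close> the linear part
  cancels against \<open>sqrt K * u\<close> and the quadratic part gives \<open>- u^2 / 2\<close>. A
  fixed \<open>u\<close> lies in the support for all large \<open>K\<close>.\<close>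

lemma scaled_gamma_tendsto: "(\<lambda>K. scaled_gamma K u) \<longlonglongrightarrow> exp (- u\<^sup>2 / 2)"
proof -
  have "(\<lambda>K::nat. exp ((real K - 1) * ln (1 + u / sqrt K) - sqrt K * u)) \<longlonglongrightarrow> exp (- (u * u / 2))"
    by real_asymp
  moreover have "\<forall>\<^sub>F K in sequentially. - sqrt (real K) < u"
    by real_asymp
  then have "\<forall>\<^sub>F K in sequentially.
      exp ((real K - 1) * ln (1 + u / sqrt K) - sqrt K * u) = scaled_gamma K u"
    using eventually_ge_at_top[of 2]
  proof eventually_elim
    case (elim K)
    then have "0 < 1 + u / sqrt K" by (simp add: field_simps)
    then have "(1 + u / sqrt K) ^ (K - 1) = exp ((real K - 1) * ln (1 + u / sqrt K))"
      using elim by (intro power_pred_eq_exp_ln) auto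
    then show ?case
      using elim by (simp add: scaled_gamma_def exp_diff exp_minus divide_inverse)
  qed
  ultimately show ?thesis by (simp add: power2_eq_square Lim_transform_eventually)
qed

lemma integrable_exp_minus_abs:
  assumes "0 < c"
  shows "integrable lborel (\<lambda>u::real. exp (- (c * \<bar>u\<bar>)))"
proof -
  have 1: "integrable lborel (exponential_density c)"
    using prob_space_exponential_density[OF assms] assms
    by (intro integrableI_nonneg)
       (auto simp: exponential_density_nonneg prob_space_def prob_space_axioms_def emeasure_density
          dest!: prob_space.emeasure_space_1)
  have 2: "integrable lborel (\<lambda>u. exponential_density c (0 + (- 1) * u))"
    by (rule lborel_integrable_real_affine[OF 1]) simp
  \<comment> \<open>Away from 0 the sum of the two one-sided densities over \<open>c\<close> equals
    the integrand; at 0 it is larger, so domination suffices.\<close>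
  have "integrable lborel (\<lambda>u. (exponential_density c u + exponential_density c (0 + (- 1) * u)) / c)"
    using 1 2 by simp
  then show ?thesis
    by (rule Bochner_Integration.integrable_bound)
       (use assms in \<open>auto simp: exponential_density_def abs_if mult_ac add_divide_distrib\<close>)
qed

lemma integrable_gamma_dominator: "integrable lborel (\<lambda>u::real. exp (5 / 4 - \<bar>u\<bar> / 4))"
  using integrable_exp_minus_abs[of "1/4", THEN integrable_mult_right, of "exp (5/4)"]
  by (simp flip: exp_add)

lemma integral_gauss: "(\<integral>u. exp (- (u::real)\<^sup>2 / 2) \<partial>lborel) = sqrt (2 * pi)"
proof -
  have "(\<integral>u. std_normal_density u \<partial>lborel) = 1"
    by (rule integral_normal_density) simp
  then show ?thesis unfolding std_normal_density_def by simp
qed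

text \<open>Dominated convergence to the Gaussian integral. The index is shifted by 2 because the
  dominating function is available from \<open>K = 2\<close> on.\<close>

lemma scaled_gamma_integral_tendsto:
  "(\<lambda>K. \<integral>u. scaled_gamma K u \<partial>lborel) \<longlonglongrightarrow> sqrt (2 * pi)"
proof -
  have "(\<lambda>K. \<integral>u. scaled_gamma (K + 2) u \<partial>lborel) \<longlonglongrightarrow> (\<integral>u. exp (- u\<^sup>2 / 2) \<partial>lborel)"
    by (rule integral_dominated_convergence[OF _ _ integrable_gamma_dominator])
       (auto simp: scaled_gamma_nonneg scaled_gamma_le simp del: add_2_eq_Suc'
          intro!: LIMSEQ_ignore_initial_segment scaled_gamma_tendsto[simplified])
  then show ?thesis
    unfolding integral_gauss by (rule LIMSEQ_offset)
qed

text \<open>The two functions are proportional with a constant \<open>C\<close> that need not be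
  evaluated: the Erlang density integrates to one, so \<open>C\<close> is the reciprocal of the
  integral of \<open>scaled_gamma K\<close>.\<close>

lemma erlang_density_eq_scaled_gamma:
  assumes "2 \<le> K"
  shows "sqrt K * erlang_density (K - 1) 1 (K + sqrt K * u)
    = scaled_gamma K u / (\<integral>u. scaled_gamma K u \<partial>lborel)"
proof -
  define C where "C = sqrt K * real K ^ (K - 1) * exp (- real K) / fact (K - 1)"
  have K: "0 < sqrt K" using assms by simp
  have eq: "sqrt K * erlang_density (K - 1) 1 (K + sqrt K * u) = C * scaled_gamma K u" for u
  proof (cases "- sqrt K < u")
    case True
    have "K * (1 + u / sqrt K) = K + (K / sqrt K) * u" by (simp add: algebra_simps)
    then have 1: "K + sqrt K * u = K * (1 + u / sqrt K)"
      by (simp add: real_div_sqrt)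
    have "0 < 1 + u / sqrt K" using True K by (simp add: field_simps)
    then have "0 < K + sqrt K * u" unfolding 1 using assms by (intro mult_pos_pos) auto
    then have "erlang_density (K - 1) 1 (K + sqrt K * u) =
        (K * (1 + u / sqrt K)) ^ (K - 1) * exp (- (K + sqrt K * u)) / fact (K - 1)"
      by (simp add: erlang_density_def flip: 1)
    then show ?thesis
      using True by (simp add: C_def scaled_gamma_def power_mult_distrib exp_diff exp_minus divide_inverse)
  next
    case False
    have "K + sqrt K * u = sqrt K * (sqrt K + u)" by (simp add: algebra_simps)
    then have "K + sqrt K * u \<le> 0"
      using False K by (simp add: mult_le_0_iff)
    \<comment> \<open>At the left end of the support the Erlang density is
      \<open>0 ^ (K - 1)\<close>, which is 0 since \<open>2 \<le> K\<close>.\<close>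
    then show ?thesis
      using False assms by (cases "K + sqrt K * u = 0") (auto simp: erlang_density_def scaled_gamma_def)
  qed
  interpret E: prob_space "density lborel (erlang_density (K - 1) 1)"
    by (rule prob_space_erlang_density) simp
  have "(\<integral>x. erlang_density (K - 1) 1 x \<partial>lborel) = measure (density lborel (erlang_density (K - 1) 1)) UNIV"
    by (subst measure_def, subst emeasure_density) (auto simp: integral_eq_nn_integral)
  also have "\<dots> = 1" using E.prob_space by simp
  finally have "1 = (\<integral>x. erlang_density (K - 1) 1 x \<partial>lborel)" by simp
  also have "\<dots> = sqrt K * (\<integral>u. erlang_density (K - 1) 1 (K + sqrt K * u) \<partial>lborel)"
    using lborel_integral_real_affine[of "sqrt K" "erlang_density (K - 1) 1" "real K"] K by simp
  also have "\<dots> = C * (\<integral>u. scaled_gamma K u \<partial>lborel)"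
    by (simp only: eq integral_mult_right_zero[symmetric])
  finally have 1: "1 = C * (\<integral>u. scaled_gamma K u \<partial>lborel)" .
  then have "(\<integral>u. scaled_gamma K u \<partial>lborel) \<noteq> 0" by auto
  with 1 show ?thesis unfolding eq by (simp add: field_simps)
qed

text \<open>The \<open>L1\<close> distance between the standardised Gamma law of shape
  \<open>K\<close> and the standard normal law. It is the error shared by the posterior
  approximation and by the coverage probability.\<close>

definition erlang_normal_dist :: "nat \<Rightarrow> real" where
  "erlang_normal_dist K =
     (\<integral>u. \<bar>sqrt K * erlang_density (K - 1) 1 (K + sqrt K * u) - std_normal_density u\<bar> \<partial>lborel)"

lemma erlang_normal_dist_nonneg: "0 \<le> erlang_normal_dist K"
  by (simp add: erlang_normal_dist_def)

lemma erlang_normal_dist_tendsto: "erlang_normal_dist \<longlonglongrightarrow> 0"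
proof -
  let ?I = "\<lambda>K. \<integral>u. scaled_gamma K u \<partial>lborel"
  have lim: "?I \<longlonglongrightarrow> sqrt (2 * pi)" by (rule scaled_gamma_integral_tendsto)
  \<comment> \<open>As \<open>sqrt (2 * pi)\<close> exceeds 1, from some \<open>K0\<close> on
    division by the integral only decreases the function, so the earlier dominating function still
    applies. The shift by \<open>K0 + 2\<close> below secures this together with
    \<open>2 \<le> K\<close>.\<close>
  have "\<forall>\<^sub>F K in sequentially. 1 < ?I K"
    by (rule order_tendstoD(1)[OF lim]) (use pi_gt3 in simp)
  then obtain K0 where K0: "\<And>K. K0 \<le> K \<Longrightarrow> 1 < ?I K"
    by (auto simp: eventually_sequentially)
  let ?f = "\<lambda>K u. \<bar>scaled_gamma K u / ?I K - std_normal_density u\<bar>"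
  have "(\<lambda>K. \<integral>u. ?f (K + (K0 + 2)) u \<partial>lborel) \<longlonglongrightarrow> (\<integral>u. 0 \<partial>(lborel :: real measure))"
  proof (rule integral_dominated_convergence[where w = "\<lambda>u. exp (5 / 4 - \<bar>u\<bar> / 4) + std_normal_density u"])
    show "integrable lborel (\<lambda>u. exp (5 / 4 - \<bar>u\<bar> / 4) + std_normal_density u)"
      by (intro Bochner_Integration.integrable_add integrable_gamma_dominator integrable_normal_density) simp
    show "AE u in lborel. (\<lambda>K. ?f (K + (K0 + 2)) u) \<longlonglongrightarrow> 0"
    proof (rule AE_I2)
      fix u
      have "(\<lambda>K. ?f K u) \<longlonglongrightarrow> \<bar>exp (- u\<^sup>2 / 2) / sqrt (2 * pi) - std_normal_density u\<bar>"
        by (intro tendsto_intros scaled_gamma_tendsto lim) simp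
      then show "(\<lambda>K. ?f (K + (K0 + 2)) u) \<longlonglongrightarrow> 0"
        by (intro LIMSEQ_ignore_initial_segment) (simp add: std_normal_density_def)
    qed
    show "AE u in lborel. norm (?f (K + (K0 + 2)) u) \<le> exp (5 / 4 - \<bar>u\<bar> / 4) + std_normal_density u" for K
    proof (rule AE_I2)
      fix u
      let ?K = "K + (K0 + 2)"
      have "scaled_gamma ?K u / ?I ?K \<le> scaled_gamma ?K u"
        using K0[of ?K] scaled_gamma_nonneg[of ?K u] by (simp add: divide_le_eq mult_le_cancel_left1)
      also have "\<dots> \<le> exp (5 / 4 - \<bar>u\<bar> / 4)" by (rule scaled_gamma_le) simp
      finally have 1: "scaled_gamma ?K u / ?I ?K \<le> exp (5 / 4 - \<bar>u\<bar> / 4)" .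
      have 2: "0 \<le> scaled_gamma ?K u / ?I ?K"
        using K0[of ?K] scaled_gamma_nonneg[of ?K u] by simp
      show "norm (?f ?K u) \<le> exp (5 / 4 - \<bar>u\<bar> / 4) + std_normal_density u"
        using 1 2 normal_density_nonneg[of 0 1 u] unfolding real_norm_def abs_abs abs_le_iff by linarith
    qed
  qed auto
  then have "(\<lambda>K. \<integral>u. ?f (K + (K0 + 2)) u \<partial>lborel) \<longlonglongrightarrow> 0" by simp
  moreover have "erlang_normal_dist (K + (K0 + 2)) = (\<integral>u. ?f (K + (K0 + 2)) u \<partial>lborel)" for K
  proof -
    have "2 \<le> K + (K0 + 2)" by simp
    then show ?thesis
      by (simp only: erlang_normal_dist_def erlang_density_eq_scaled_gamma)
  qed
  ultimately have "(\<lambda>K. erlang_normal_dist (K + (K0 + 2))) \<longlonglongrightarrow> 0"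
    by presburger
  then show ?thesis by (rule LIMSEQ_offset)
qed

lemma measure_density_eq_integral:
  fixes f :: "'a \<Rightarrow> real"
  assumes "f \<in> borel_measurable M" "\<And>x. 0 \<le> f x" "B \<in> sets M"
  shows "measure (density M f) B = (\<integral>x. f x * indicator B x \<partial>M)"
proof -
  have "emeasure (density M f) B = (\<integral>\<^sup>+x. ennreal (f x * indicator B x) \<partial>M)"
    using assms by (subst emeasure_density) (auto intro!: nn_integral_cong split: split_indicator)
  then show ?thesis
    using assms by (simp add: measure_def integral_eq_nn_integral)
qed

lemma integrable_prob_density:
  fixes f :: "'a \<Rightarrow> real"
  assumes "f \<in> borel_measurable M" "\<And>x. 0 \<le> f x" "prob_space (density M f)"
  shows "integrable M f"
  using prob_space.emeasure_space_1[OF assms(3)] assms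
  by (intro integrableI_nonneg) (auto simp: emeasure_density)

text \<open>The difference of the densities integrated over \<open>B\<close> is at most their
  \<open>L1\<close> distance, which the substitution \<open>x = K + sqrt K * u\<close> turns into
  \<open>erlang_normal_dist K\<close>.\<close>

lemma erlang_normal_measure_diff:
  assumes K: "1 \<le> K" and [measurable]: "B \<in> sets borel"
  shows "\<bar>measure (density lborel (erlang_density (K - 1) 1)) B
      - measure (density lborel (normal_density K (sqrt K))) B\<bar> \<le> erlang_normal_dist K"
proof -
  let ?e = "erlang_density (K - 1) 1" and ?n = "normal_density K (sqrt K)"
  have s: "0 < sqrt K" using K by simp
  have e: "integrable lborel ?e"
    by (rule integrable_prob_density) (auto intro: prob_space_erlang_density)
  have n: "integrable lborel ?n" using s by (rule integrable_normal_density)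
  have n': "sqrt K * ?n (K + sqrt K * u) = std_normal_density u" for u
    using s K by (simp add: normal_density_def power_mult_distrib real_sqrt_mult)
  let ?d = "\<lambda>x. (?e x - ?n x) * indicator B x"
  have d: "integrable lborel ?d"
    using e n by (intro integrable_real_mult_indicator Bochner_Integration.integrable_diff) auto
  have "measure (density lborel ?e) B - measure (density lborel ?n) B = (\<integral>x. ?d x \<partial>lborel)"
    using e n by (subst (1 2) measure_density_eq_integral)
      (auto simp: left_diff_distrib intro!: Bochner_Integration.integral_diff[symmetric] integrable_real_mult_indicator)
  also have "\<bar>\<dots>\<bar> \<le> (\<integral>x. \<bar>?e x - ?n x\<bar> \<partial>lborel)"
  proof -
    have "\<bar>\<integral>x. ?d x \<partial>lborel\<bar> \<le> (\<integral>x. \<bar>?d x\<bar> \<partial>lborel)"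
      by (rule integral_abs_bound)
    also have "\<dots> \<le> (\<integral>x. \<bar>?e x - ?n x\<bar> \<partial>lborel)"
      using d e n by (intro integral_mono) (auto split: split_indicator)
    finally show ?thesis .
  qed
  also have "\<dots> = sqrt K * (\<integral>u. \<bar>?e (K + sqrt K * u) - ?n (K + sqrt K * u)\<bar> \<partial>lborel)"
    using lborel_integral_real_affine[of "sqrt K" "\<lambda>x. \<bar>?e x - ?n x\<bar>" "real K"] s by simp
  also have "\<dots> = (\<integral>u. \<bar>sqrt K * ?e (K + sqrt K * u) - sqrt K * ?n (K + sqrt K * u)\<bar> \<partial>lborel)"
    using s by (simp add: abs_mult flip: integral_mult_right_zero right_diff_distrib)
  finally show ?thesis unfolding n' erlang_normal_dist_def .
qed

section \<open>Products of exponential laws\<close>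

text \<open>Product measures are determined by their values on rectangles, and there the integral of
  a product of functions of single coordinates factorises.\<close>

lemma PiM_density:
  fixes f :: "'i \<Rightarrow> 'a \<Rightarrow> ennreal"
  assumes I: "finite I" and f [measurable]: "\<And>i. i \<in> I \<Longrightarrow> f i \<in> borel_measurable (M i)"
    and M: "product_sigma_finite M" and D: "product_sigma_finite (\<lambda>i. density (M i) (f i))"
  shows "PiM I (\<lambda>i. density (M i) (f i)) = density (PiM I M) (\<lambda>x. \<Prod>i\<in>I. f i (x i))"
proof -
  interpret M: product_sigma_finite M by fact
  interpret D: product_sigma_finite "\<lambda>i. density (M i) (f i)" by fact
  show ?thesis
  proof (rule D.PiM_eqI[symmetric])
    show "sets (density (PiM I M) (\<lambda>x. \<Prod>i\<in>I. f i (x i))) = sets (PiM I (\<lambda>i. density (M i) (f i)))"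
      by (simp cong: sets_PiM_cong)
    fix A assume "\<And>i. i \<in> I \<Longrightarrow> A i \<in> sets (density (M i) (f i))"
    then have A [measurable]: "\<And>i. i \<in> I \<Longrightarrow> A i \<in> sets (M i)" by simp
    have meas: "(\<lambda>x. \<Prod>i\<in>I. f i (x i)) \<in> borel_measurable (PiM I M)"
      by measurable
    have "emeasure (density (PiM I M) (\<lambda>x. \<Prod>i\<in>I. f i (x i))) (Pi\<^sub>E I A)
        = (\<integral>\<^sup>+x. (\<Prod>i\<in>I. f i (x i)) * indicator (Pi\<^sub>E I A) x \<partial>PiM I M)"
      using I A meas by (intro emeasure_density) (auto intro: sets_PiM_I_finite)
    also have "\<dots> = (\<integral>\<^sup>+x. (\<Prod>i\<in>I. f i (x i) * indicator (A i) (x i)) \<partial>PiM I M)"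
    proof (intro nn_integral_cong)
      fix x assume "x \<in> space (PiM I M)"
      then have "indicator (Pi\<^sub>E I A) x = (\<Prod>i\<in>I. indicator (A i) (x i) :: ennreal)"
        using I by (auto simp: space_PiM PiE_def Pi_def indicator_def)
      then show "(\<Prod>i\<in>I. f i (x i)) * indicator (Pi\<^sub>E I A) x = (\<Prod>i\<in>I. f i (x i) * indicator (A i) (x i))"
        by (simp add: prod.distrib)
    qed
    also have "\<dots> = (\<Prod>i\<in>I. \<integral>\<^sup>+x. f i x * indicator (A i) x \<partial>M i)"
      using I by (intro M.product_nn_integral_prod) auto
    also have "\<dots> = (\<Prod>i\<in>I. emeasure (density (M i) (f i)) (A i))"
      by (intro prod.cong refl) (simp add: emeasure_density)
    finally show "emeasure (density (PiM I M) (\<lambda>x. \<Prod>i\<in>I. f i (x i))) (Pi\<^sub>E I A)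
        = (\<Prod>i\<in>I. emeasure (density (M i) (f i)) (A i))" .
  qed fact
qed

text \<open>The joint law of the coordinates is the product measure itself, whose factors are the
  laws of the single coordinates.\<close>

lemma indep_vars_PiM_components:
  assumes "I \<noteq> {}" "\<And>i. i \<in> I \<Longrightarrow> prob_space (M i)"
  shows "prob_space.indep_vars (PiM I M) M (\<lambda>i x. x i) I"
proof -
  interpret prob_space "PiM I M" by (rule prob_space_PiM) fact
  have "distr (PiM I M) (PiM I M) (\<lambda>x. \<lambda>i\<in>I. x i) = distr (PiM I M) (PiM I M) (\<lambda>x. x)"
    by (intro distr_cong) (auto simp: space_PiM PiE_def extensional_restrict)
  also have "\<dots> = (\<Pi>\<^sub>M i\<in>I. distr (PiM I M) (M i) (\<lambda>x. x i))"
    by (simp add: distr_id assms(2) distr_PiM_component cong: PiM_cong)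
  finally show ?thesis
    by (subst indep_vars_iff_distr_eq_PiM'[OF assms(1)]) auto
qed

text \<open>This is Bayes' formula with an unnormalised density \<open>\<rho>\<close> that is close
  to 1 in mean: one \<open>\<epsilon>\<close> pays for the numerator, the other for the normalising
  constant.\<close>

lemma (in prob_space) normalized_density_diff:
  fixes \<rho> :: "'a \<Rightarrow> real"
  assumes \<rho>: "integrable M \<rho>" "\<And>x. 0 \<le> \<rho> x" and B [measurable]: "B \<in> sets M"
    and le: "(\<integral>x. \<bar>\<rho> x - 1\<bar> \<partial>M) \<le> \<epsilon>"
  shows "\<bar>(\<integral>x. \<rho> x * indicator B x \<partial>M) / (\<integral>x. \<rho> x \<partial>M) - prob B\<bar> \<le> 2 * \<epsilon>"
proof -
  define c b where "c = (\<integral>x. \<rho> x \<partial>M)" and "b = (\<integral>x. \<rho> x * indicator B x \<partial>M)"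
  have [measurable]: "\<rho> \<in> borel_measurable M" using \<rho> by simp
  have iB: "integrable M (\<lambda>x. \<rho> x * indicator B x)"
    using \<rho> by (intro integrable_real_mult_indicator) auto
  have i1: "integrable M (\<lambda>x. \<bar>\<rho> x - 1\<bar>)" using \<rho> by auto
  have bc: "0 \<le> b" "b \<le> c"
    unfolding b_def c_def using \<rho> iB
    by (auto intro!: Bochner_Integration.integral_nonneg integral_mono split: split_indicator)
  have "\<bar>c - 1\<bar> = \<bar>\<integral>x. (\<rho> x - 1) \<partial>M\<bar>"
    using \<rho> by (simp add: c_def prob_space)
  also have "\<dots> \<le> \<epsilon>"
    using integral_abs_bound[of M "\<lambda>x. \<rho> x - 1"] le by linarith
  finally have c1: "\<bar>c - 1\<bar> \<le> \<epsilon>" .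
  have "b - prob B = (\<integral>x. (\<rho> x - 1) * indicator B x \<partial>M)"
    using iB by (simp add: b_def left_diff_distrib integrable_real_indicator less_top[symmetric])
  also have "\<bar>\<dots>\<bar> \<le> (\<integral>x. \<bar>(\<rho> x - 1) * indicator B x\<bar> \<partial>M)"
    by (rule integral_abs_bound)
  also have "\<dots> \<le> (\<integral>x. \<bar>\<rho> x - 1\<bar> \<partial>M)"
    using \<rho> i1 by (intro integral_mono integrable_abs integrable_real_mult_indicator) (auto split: split_indicator)
  finally have b1: "\<bar>b - prob B\<bar> \<le> \<epsilon>" using le by linarith
  show ?thesis
  proof (cases "c = 0")
    case True
    \<comment> \<open>Division by 0 yields 0, and \<open>\<bar>c - 1\<bar> \<le> \<epsilon>\<close>
      forces \<open>1 \<le> \<epsilon>\<close>, so the trivial bound is enough.\<close>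
    have "prob B \<le> 2 * \<epsilon>" using True c1 prob_le_1[of B] by linarith
    then show ?thesis by (simp add: True[unfolded c_def])
  next
    case False
    \<comment> \<open>Because \<open>b / c\<close> lies in \<open>[0, 1]\<close>, normalisation
      costs at most \<open>\<bar>1 - c\<bar>\<close>, however small \<open>c\<close> is.\<close>
    then have "b / c - b = (b / c) * (1 - c)" by (simp add: field_simps)
    moreover have "0 \<le> b / c" "b / c \<le> 1" using bc False by auto
    ultimately have "\<bar>b / c - b\<bar> \<le> 1 * \<bar>1 - c\<bar>"
      by (simp only: abs_mult) (intro mult_right_mono, auto)
    moreover have "\<bar>b / c - prob B\<bar> \<le> \<bar>b / c - b\<bar> + \<bar>b - prob B\<bar>"
      using abs_triangle_ineq[of "b / c - b" "b - prob B"] by simp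
    ultimately have "\<bar>b / c - prob B\<bar> \<le> 2 * \<epsilon>"
      using b1 c1 abs_minus_commute[of c 1] by simp
    then show ?thesis by (simp add: b_def c_def)
  qed
qed

text \<open>The law of \<open>A - E\<close> for an exponential variable \<open>E\<close> of rate
  \<open>m\<close>. With \<open>A\<close> the minimum of one cell and \<open>m\<close> equal to
  \<open>n\<close> times its width, it is the posterior of that coefficient under a flat
  prior.\<close>

definition reflected_exp :: "real \<Rightarrow> real \<Rightarrow> real measure" where
  "reflected_exp m A = density lborel (\<lambda>a. exponential_density m (A - a))"

lemma sets_reflected_exp [simp, measurable_cong]: "sets (reflected_exp m A) = sets borel"
  and space_reflected_exp [simp]: "space (reflected_exp m A) = UNIV"
  by (simp_all add: reflected_exp_def)

lemma distr_reflected_exp: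
  assumes "0 < m"
  shows "distr (reflected_exp m A) lborel (\<lambda>a. A - a) = density lborel (exponential_density m)"
proof (rule measure_eqI)
  fix B :: "real set" assume "B \<in> sets (distr (reflected_exp m A) lborel (\<lambda>a. A - a))"
  then have [measurable]: "B \<in> sets borel" by simp
  have "emeasure (distr (reflected_exp m A) lborel (\<lambda>a. A - a)) B
      = (\<integral>\<^sup>+a. ennreal (exponential_density m (A - a)) * indicator B (A - a) \<partial>lborel)"
    by (subst emeasure_distr) (auto simp: reflected_exp_def emeasure_density vimage_def indicator_def intro!: nn_integral_cong)
  also have "\<dots> = (\<integral>\<^sup>+x. ennreal (exponential_density m x) * indicator B x \<partial>lborel)"
    using nn_integral_real_affine[of "\<lambda>x. ennreal (exponential_density m x) * indicator B x" "-1" A] by simp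
  also have "\<dots> = emeasure (density lborel (exponential_density m)) B"
    by (simp add: emeasure_density)
  finally show "emeasure (distr (reflected_exp m A) lborel (\<lambda>a. A - a)) B
      = emeasure (density lborel (exponential_density m)) B" .
qed simp

lemma prob_space_reflected_exp:
  assumes "0 < m"
  shows "prob_space (reflected_exp m A)"
proof -
  interpret E: prob_space "density lborel (exponential_density m)"
    by (rule prob_space_exponential_density) fact
  have "emeasure (distr (reflected_exp m A) lborel (\<lambda>a. A - a)) UNIV = 1"
    unfolding distr_reflected_exp[OF assms] using E.emeasure_space_1 by simp
  then show ?thesis
    by (intro prob_spaceI) (simp add: emeasure_distr)
qed

lemma distributed_reflected_exp:
  assumes "0 < m"
  shows "distributed (reflected_exp m A) lborel (\<lambda>a. m * (A - a)) (exponential_density 1)"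
proof -
  interpret prob_space "reflected_exp m A" by (rule prob_space_reflected_exp) fact
  have "distributed (reflected_exp m A) lborel (\<lambda>a. A - a) (exponential_density m)"
    unfolding distributed_def by (simp add: distr_reflected_exp assms)
  from erlang_distributed_mult_const[OF this assms assms] show ?thesis
    using assms by simp
qed

lemma AE_reflected_exp: "AE a in reflected_exp m A. a \<le> A"
  unfolding reflected_exp_def by (subst AE_density) (auto simp: exponential_density_def)

text \<open>Reduces the moment of order \<open>\<beta>\<close> of an exponential variable to its
  mean, so that no Gamma function appears in the bounds.\<close>

lemma powr_le_one_plus:
  fixes b \<beta> :: real
  assumes "0 \<le> b" "0 < \<beta>" "\<beta> \<le> 1"
  shows "b powr \<beta> \<le> 1 + b"
proof (cases "b \<le> 1")
  case True
  then show ?thesis using assms powr_le1[of \<beta> b] by linarith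
next
  case False
  then show ?thesis using assms powr_mono[of \<beta> 1 b] by simp
qed

text \<open>The variable \<open>b = m * (A - a)\<close> is standard exponential and \<open>\<bar>a -
  A\<bar> powr \<beta> = b powr \<beta> * m powr - \<beta>\<close>. The Hoelder bound is therefore
  dominated by a multiple of \<open>1 + b\<close>, which is integrable.\<close>

lemma reflected_exp_holder_ratio:
  fixes g :: "real \<Rightarrow> real"
  assumes m: "0 < m" and \<beta>: "0 < \<beta>" "\<beta> \<le> 1" and [measurable]: "g \<in> borel_measurable borel"
    and pos: "\<And>x. 0 < g x" and C: "0 \<le> C" and holder: "\<And>x y. \<bar>g x - g y\<bar> \<le> C * \<bar>x - y\<bar> powr \<beta>"
  shows "integrable (reflected_exp m A) (\<lambda>a. g a / g A)"
    and "(\<integral>a. \<bar>g a / g A - 1\<bar> \<partial>reflected_exp m A) \<le> 2 * C / g A * m powr - \<beta>"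
proof -
  interpret prob_space "reflected_exp m A" by (rule prob_space_reflected_exp) fact
  note D = distributed_reflected_exp[OF m, of A]
  let ?c = "C / g A * m powr - \<beta>"
  let ?h = "\<lambda>a. ?c * (1 + m * (A - a))"
  have int0: "integrable (reflected_exp m A) (\<lambda>a. m * (A - a))"
    using erlang_ith_moment_integrable[OF _ D, of 1] by simp
  have inth: "integrable (reflected_exp m A) ?h"
    using int0 by (intro integrable_mult_right Bochner_Integration.integrable_add) auto
  have "AE a in reflected_exp m A. norm (g a / g A - 1) \<le> ?h a"
    using AE_reflected_exp
  proof eventually_elim
    case (elim a)
    have "\<bar>a - A\<bar> powr \<beta> = (m * (A - a)) powr \<beta> * m powr - \<beta>"
      using elim m by (simp add: powr_mult powr_minus abs_if)
    also have "\<dots> \<le> (1 + m * (A - a)) * m powr - \<beta>"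
      using elim m \<beta> by (intro mult_right_mono powr_le_one_plus) auto
    finally have "C * \<bar>a - A\<bar> powr \<beta> / g A \<le> C * ((1 + m * (A - a)) * m powr - \<beta>) / g A"
      using C pos[of A] by (intro divide_right_mono mult_left_mono) auto
    moreover have "\<bar>g a / g A - 1\<bar> = \<bar>g a - g A\<bar> / g A"
      using pos[of A] by (simp add: field_simps abs_div_pos[symmetric])
    moreover have "\<bar>g a - g A\<bar> / g A \<le> C * \<bar>a - A\<bar> powr \<beta> / g A"
      using holder pos[of A] by (intro divide_right_mono) auto
    ultimately show ?case by (simp add: mult_ac)
  qed
  note bound = this
  have int: "integrable (reflected_exp m A) (\<lambda>a. g a / g A - 1)"
  proof (rule Bochner_Integration.integrable_bound[OF inth])
    show "AE a in reflected_exp m A. norm (g a / g A - 1) \<le> norm (?h a)"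
      using bound by eventually_elim (metis abs_ge_self order_trans real_norm_def)
  qed simp
  have "integrable (reflected_exp m A) (\<lambda>a. (g a / g A - 1) + 1)"
    using int by (intro Bochner_Integration.integrable_add) auto
  then show "integrable (reflected_exp m A) (\<lambda>a. g a / g A)" by simp
  have "(\<integral>a. \<bar>g a / g A - 1\<bar> \<partial>reflected_exp m A) \<le> (\<integral>a. ?h a \<partial>reflected_exp m A)"
    using int inth bound by (intro integral_mono_AE) auto
  also have "\<dots> = ?c * (1 + (\<integral>a. m * (A - a) \<partial>reflected_exp m A))"
    using int0 prob_space[unfolded space_reflected_exp]
    by (subst integral_mult_right_zero, subst Bochner_Integration.integral_add) auto
  \<comment> \<open>The factor 2 is the mean of \<open>1 + b\<close> for a standard exponential
    \<open>b\<close>.\<close>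
  also have "\<dots> = ?c * 2"
    using exponential_distributed_expectation[OF _ D] by simp
  finally show "(\<integral>a. \<bar>g a / g A - 1\<bar> \<partial>reflected_exp m A) \<le> 2 * C / g A * m powr - \<beta>"
    by (simp add: mult_ac)
qed

text \<open>With \<open>A\<close> the MLE coefficients and \<open>m j\<close> equal to
  \<open>n\<close> times the width of cell \<open>j\<close>, this is the posterior that a flat prior
  would give. It is the reference law for the actual posterior.\<close>

definition exp_product :: "nat \<Rightarrow> (nat \<Rightarrow> real) \<Rightarrow> (nat \<Rightarrow> real) \<Rightarrow> (nat \<Rightarrow> real) measure" where
  "exp_product K m A = PiM {1..K} (\<lambda>j. reflected_exp (m j) (A j))"

lemma sets_exp_product [simp, measurable_cong]: "sets (exp_product K m A) = sets (param_space K)"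
  unfolding exp_product_def by (intro sets_PiM_cong) auto

lemma space_exp_product [simp]: "space (exp_product K m A) = space (param_space K)"
  by (rule sets_eq_imp_space_eq) simp

context
  fixes K :: nat and m A :: "nat \<Rightarrow> real"
  assumes m: "\<And>j. j \<in> {1..K} \<Longrightarrow> 0 < m j"
begin

text \<open>Positive outside of \<open>{1..K}\<close> as well, since the library's locale for products asks for
  \<open>\<sigma>\<close>-finite factors at all indices.\<close>

private abbreviation "m' j \<equiv> if j \<in> {1..K} then m j else 1"

lemma exp_product_cong: "exp_product K m A = PiM {1..K} (\<lambda>j. reflected_exp (m' j) (A j))"
  unfolding exp_product_def by (intro PiM_cong) auto

lemma product_prob_space_reflected_exp: "product_prob_space (\<lambda>j. reflected_exp (m' j) (A j))"
proof -
  have "prob_space (reflected_exp (m' j) (A j))" for j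
    using m by (intro prob_space_reflected_exp) auto
  then show ?thesis
    by (intro product_prob_space.intro product_sigma_finite.intro product_prob_space_axioms.intro
      prob_space_imp_sigma_finite)
qed

lemma prob_space_exp_product: "prob_space (exp_product K m A)"
  unfolding exp_product_def using m by (intro prob_space_PiM prob_space_reflected_exp)

lemma exp_product_eq_density:
  "exp_product K m A = density (param_space K) (\<lambda>a. \<Prod>j=1..K. ennreal (exponential_density (m j) (A j - a j)))"
proof -
  interpret product_prob_space "\<lambda>j. reflected_exp (m' j) (A j)"
    by (rule product_prob_space_reflected_exp)
  have "exp_product K m A = PiM {1..K} (\<lambda>j. density lborel (\<lambda>a. ennreal (exponential_density (m' j) (A j - a))))"
    unfolding exp_product_cong reflected_exp_def ..
  also have "\<dots> = density (param_space K) (\<lambda>a. \<Prod>j=1..K. ennreal (exponential_density (m' j) (A j - a j)))"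
  proof (rule PiM_density)
    show "product_sigma_finite (\<lambda>j. lborel :: real measure)" ..
    show "product_sigma_finite (\<lambda>j. density lborel (\<lambda>a. ennreal (exponential_density (m' j) (A j - a))))"
      using product_sigma_finite_axioms by (simp only: reflected_exp_def)
  qed auto
  also have "\<dots> = density (param_space K) (\<lambda>a. \<Prod>j=1..K. ennreal (exponential_density (m j) (A j - a j)))"
    by (intro arg_cong2[where f = density] refl ext prod.cong) auto
  finally show ?thesis .
qed

text \<open>The summands are independent standard exponential variables, and a sum of
  \<open>K\<close> of these is Gamma distributed with shape \<open>K\<close>; the Erlang parameter
  counts from 0.\<close>

lemma exp_product_sum_distributed:
  assumes K: "1 \<le> K"
  shows "distributed (exp_product K m A) lborel (\<lambda>a. \<Sum>j=1..K. m j * (A j - a j)) (erlang_density (K - 1) 1)"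
proof -
  interpret prob_space "exp_product K m A" by (rule prob_space_exp_product)
  have ind: "indep_vars (\<lambda>j. reflected_exp (m j) (A j)) (\<lambda>j a. a j) {1..K}"
    unfolding exp_product_def using m K by (intro indep_vars_PiM_components prob_space_reflected_exp) auto
  then have "indep_vars (\<lambda>_. borel) (\<lambda>j a. m j * (A j - a j)) {1..K}"
    by (rule indep_vars_compose2) auto
  moreover have "distributed (exp_product K m A) lborel (\<lambda>a. m j * (A j - a j)) (exponential_density 1)"
    if j: "j \<in> {1..K}" for j
  proof -
    have [measurable]: "(\<lambda>a. a j) \<in> measurable (exp_product K m A) (reflected_exp (m j) (A j))"
      using j unfolding exp_product_def by measurable
    have D: "distr (exp_product K m A) (reflected_exp (m j) (A j)) (\<lambda>a. a j) = reflected_exp (m j) (A j)"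
      unfolding exp_product_def using m j by (intro distr_PiM_component prob_space_reflected_exp) auto
    have "distr (exp_product K m A) lborel (\<lambda>a. m j * (A j - a j))
        = distr (distr (exp_product K m A) (reflected_exp (m j) (A j)) (\<lambda>a. a j)) lborel (\<lambda>a. m j * (A j - a))"
      by (subst distr_distr) (auto simp: comp_def)
    also have "\<dots> = density lborel (exponential_density 1)"
      unfolding D using distributed_reflected_exp[OF m[OF j], of "A j"] by (simp add: distributed_def)
    finally show ?thesis
      using measurable_compose[OF \<open>(\<lambda>a. a j) \<in> _\<close>, of "\<lambda>a. m j * (A j - a)" borel]
      by (simp add: distributed_def exponential_density_nonneg)
  qed
  ultimately have "distributed (exp_product K m A) lborel (\<lambda>a. \<Sum>j\<in>{1..K}. m j * (A j - a j)) (erlang_density (card {1..K} - 1) 1)"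
    using K by (intro exponential_distributed_sum) auto
  then show ?thesis by simp
qed

text \<open>After the passage to \<open>\<Prod>j. 1 + \<bar>r j - 1\<bar>\<close> the integral
  factorises over the cells, and each factor is at most
  \<open>1 + \<delta> \<le> exp \<delta>\<close>. Thus the errors of the cells add up in the
  exponent.\<close>

lemma exp_product_holder_ratio:
  fixes g :: "real \<Rightarrow> real" and \<delta> :: real
  assumes \<beta>: "0 < \<beta>" "\<beta> \<le> 1" and [measurable]: "g \<in> borel_measurable borel"
    and pos: "\<And>x. 0 < g x" and C: "0 \<le> C" and holder: "\<And>x y. \<bar>g x - g y\<bar> \<le> C * \<bar>x - y\<bar> powr \<beta>"
    and \<delta>: "\<And>j. j \<in> {1..K} \<Longrightarrow> 2 * C / g (A j) * m j powr - \<beta> \<le> \<delta>"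
  shows "integrable (exp_product K m A) (\<lambda>a. \<Prod>j=1..K. g (a j) / g (A j))"
    and "(\<integral>a. \<bar>(\<Prod>j=1..K. g (a j) / g (A j)) - 1\<bar> \<partial>exp_product K m A) \<le> exp (K * \<delta>) - 1"
proof -
  interpret product_prob_space "\<lambda>j. reflected_exp (m' j) (A j)"
    by (rule product_prob_space_reflected_exp)
  interpret Q: prob_space "exp_product K m A" by (rule prob_space_exp_product)
  let ?r = "\<lambda>j a. g a / g (A j)"
  have r: "integrable (reflected_exp (m' j) (A j)) (?r j)"
      "(\<integral>a. \<bar>?r j a - 1\<bar> \<partial>reflected_exp (m' j) (A j)) \<le> \<delta>" if "j \<in> {1..K}" for j
    using reflected_exp_holder_ratio[of "m' j" \<beta> g C "A j"] m[OF that] \<beta> pos C holder \<delta>[OF that] that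
    by auto
  show int: "integrable (exp_product K m A) (\<lambda>a. \<Prod>j=1..K. ?r j (a j))"
    unfolding exp_product_cong by (rule product_integrable_prod) (use r in auto)
  have dev: "integrable (reflected_exp (m' j) (A j)) (\<lambda>a. \<bar>?r j a - 1\<bar>)" if "j \<in> {1..K}" for j
    using r[OF that] by (intro M.integrable_const integrable_abs Bochner_Integration.integrable_diff)
  then have int1: "integrable (reflected_exp (m' j) (A j)) (\<lambda>a. 1 + \<bar>?r j a - 1\<bar>)" if "j \<in> {1..K}" for j
    using that by (intro Bochner_Integration.integrable_add M.integrable_const)
  have intp: "integrable (exp_product K m A) (\<lambda>a. \<Prod>j=1..K. 1 + \<bar>?r j (a j) - 1\<bar>)"
    unfolding exp_product_cong using product_integrable_prod[of "{1..K}" "\<lambda>j a. 1 + \<bar>?r j a - 1\<bar>"] int1 by simp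
  have "(\<integral>a. \<bar>(\<Prod>j=1..K. ?r j (a j)) - 1\<bar> \<partial>exp_product K m A)
      \<le> (\<integral>a. (\<Prod>j=1..K. 1 + \<bar>?r j (a j) - 1\<bar>) - 1 \<partial>exp_product K m A)"
  proof (intro integral_mono)
    fix a
    show "\<bar>(\<Prod>j=1..K. ?r j (a j)) - 1\<bar> \<le> (\<Prod>j=1..K. 1 + \<bar>?r j (a j) - 1\<bar>) - 1"
      using norm_prod_minus1_le_prod_minus1[of "\<lambda>j. ?r j (a j) - 1" "{1..K}"] by simp
  qed (use int intp in auto)
  also have "\<dots> = (\<integral>a. (\<Prod>j=1..K. 1 + \<bar>?r j (a j) - 1\<bar>) \<partial>exp_product K m A) - 1"
    using intp Q.prob_space by (subst Bochner_Integration.integral_diff) (auto simp del: space_exp_product)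
  also have "(\<integral>a. (\<Prod>j=1..K. 1 + \<bar>?r j (a j) - 1\<bar>) \<partial>exp_product K m A)
      = (\<Prod>j=1..K. \<integral>a. 1 + \<bar>?r j a - 1\<bar> \<partial>reflected_exp (m' j) (A j))"
    unfolding exp_product_cong using product_integral_prod[of "{1..K}" "\<lambda>j a. 1 + \<bar>?r j a - 1\<bar>"] int1 by simp
  also have "\<dots> \<le> (\<Prod>j=1..K. exp \<delta>)"
  proof (intro prod_mono conjI)
    fix j assume j: "j \<in> {1..K}"
    show "0 \<le> (\<integral>a. 1 + \<bar>?r j a - 1\<bar> \<partial>reflected_exp (m' j) (A j))"
      by (intro Bochner_Integration.integral_nonneg) auto
    have "(\<integral>a. 1 + \<bar>?r j a - 1\<bar> \<partial>reflected_exp (m' j) (A j))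
        = 1 + (\<integral>a. \<bar>?r j a - 1\<bar> \<partial>reflected_exp (m' j) (A j))"
      using M.prob_space[of j, unfolded space_reflected_exp]
      by (subst Bochner_Integration.integral_add[OF M.integrable_const dev[OF j]]) simp
    also have "\<dots> \<le> 1 + \<delta>" using r[OF j] by simp
    also have "\<dots> \<le> exp \<delta>" by (rule exp_ge_add_one_self)
    finally show "(\<integral>a. 1 + \<bar>?r j a - 1\<bar> \<partial>reflected_exp (m' j) (A j)) \<le> exp \<delta>" .
  qed
  also have "\<dots> = exp (K * \<delta>)" by (simp add: exp_of_nat_mult)
  finally show "(\<integral>a. \<bar>(\<Prod>j=1..K. ?r j (a j)) - 1\<bar> \<partial>exp_product K m A) \<le> exp (K * \<delta>) - 1"
    by simp
qed

end

section \<open>The posterior for a given point configuration\<close>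

declare One_nat_def [simp del]

lemma ex_grid_cell:
  fixes t :: "nat \<Rightarrow> real"
  assumes "t 0 \<le> x" "x < t K"
  shows "\<exists>j\<in>{1..K}. x \<in> {t (j - 1)..<t j}"
  using assms
proof (induction K)
  case (Suc K)
  show ?case
  proof (cases "x < t K")
    case True
    then obtain j where "j \<in> {1..K}" "x \<in> {t (j - 1)..<t j}" using Suc by auto
    then show ?thesis by (intro bexI[of _ j]) auto
  next
    case False
    then show ?thesis using Suc.prems by (intro bexI[of _ "Suc K"]) auto
  qed
qed simp

locale grid =
  fixes K :: nat and t :: "nat \<Rightarrow> real"
  assumes K_ge_1: "1 \<le> K" and t_0: "t 0 = 0" and t_K: "t K = 1"
    and t_mono: "strict_mono_on {0..K} t"
begin

definition cell :: "nat \<Rightarrow> real set" where "cell j = {t (j - 1)..<t j}"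

definition width :: "nat \<Rightarrow> real" where "width j = t j - t (j - 1)"

lemma t_less: "i < j \<Longrightarrow> j \<le> K \<Longrightarrow> t i < t j"
  using t_mono by (auto simp: strict_mono_on_def)

lemma t_le: "i \<le> j \<Longrightarrow> j \<le> K \<Longrightarrow> t i \<le> t j"
  using t_less[of i j] by (cases "i = j") auto

lemma width_pos: "j \<in> {1..K} \<Longrightarrow> 0 < width j"
  using t_less[of "j - 1" j] by (auto simp: width_def)

lemma cell_subset:
  assumes "j \<in> {1..K}"
  shows "cell j \<subseteq> {0..<1}"
proof -
  have "j - 1 \<le> K" "j \<le> K" using assms by auto
  then show ?thesis using t_le[of 0 "j - 1"] t_le[of j K] by (auto simp: cell_def t_0 t_K)
qed

lemma cell_unique:
  assumes "i \<in> {1..K}" "j \<in> {1..K}" "x \<in> cell i" "x \<in> cell j"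
  shows "i = j"
proof (rule ccontr)
  assume "i \<noteq> j"
  then consider "i \<le> j - 1" | "j \<le> i - 1" using assms by fastforce
  moreover have "i - 1 \<le> K" "j - 1 \<le> K" using assms by auto
  ultimately show False
    using assms t_le[of i "j - 1"] t_le[of j "i - 1"] by cases (auto simp: cell_def)
qed

lemma ex_cell: "0 \<le> x \<Longrightarrow> x < 1 \<Longrightarrow> \<exists>j\<in>{1..K}. x \<in> cell j"
  using ex_grid_cell[of t x K] by (simp add: cell_def t_0 t_K)

lemma step_fun_cell:
  assumes "j \<in> {1..K}" "x \<in> cell j"
  shows "step_fun K t a x = a j"
proof -
  have "step_fun K t a x = (\<Sum>i=1..K. if i = j then a j else 0)"
    unfolding step_fun_def
  proof (intro sum.cong refl)
    fix i assume "i \<in> {1..K}"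
    then have "x \<in> cell i \<longleftrightarrow> i = j" using assms cell_unique[of i j x] by blast
    then show "a i * indicator {t (i - 1)..<t i} x = (if i = j then a j else 0)"
      by (simp add: cell_def indicator_def)
  qed
  then show ?thesis using assms(1) by simp
qed

lemma theta_step_fun_width: "theta (step_fun K t a) = (\<Sum>j=1..K. a j * width j)"
proof -
  have "(LBINT x:{0..1}. indicator {t (j - 1)..<t j} x :: real) = width j" if j: "j \<in> {1..K}" for j
  proof -
    have "(LBINT x:{0..1}. indicator {t (j - 1)..<t j} x) = (LBINT x. indicator {t (j - 1)..<t j} x :: real)"
      unfolding set_lebesgue_integral_def using cell_subset[OF j]
      by (intro Bochner_Integration.integral_cong) (auto simp: cell_def indicator_def)
    also have "\<dots> = width j"
      using width_pos[OF j] by (simp add: width_def)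
    finally show ?thesis .
  qed
  then show ?thesis unfolding theta_step_fun by (intro sum.cong) auto
qed

text \<open>The regularity of a configuration that holds almost surely. The abscissa 1 is excluded
  because it lies in no half-open cell: there \<open>step_fun\<close> is 0, and a point would impose
  a constraint unrelated to the coefficients.\<close>

definition well_sampled :: "(nat \<Rightarrow> real \<times> real) \<Rightarrow> bool" where
  "well_sampled z \<longleftrightarrow> (\<forall>i. fst (z i) \<in> {0..<1}) \<and>
     (\<forall>j\<in>{1..K}. \<exists>i. fst (z i) \<in> cell j \<and> (\<forall>k. fst (z k) \<in> cell j \<longrightarrow> snd (z i) \<le> snd (z k)))"

lemma mle_coeff_attained:
  assumes "fst (z i) \<in> cell j" "\<And>k. fst (z k) \<in> cell j \<Longrightarrow> snd (z i) \<le> snd (z k)"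
  shows "mle_coeff t z j = snd (z i)"
  unfolding mle_coeff_def cell_def[symmetric] using assms by (intro Least_equality) auto

text \<open>Every point lies in some cell, and within a cell the lowest point carries the only
  binding constraint. Hence the likelihood sees the points only through the MLE
  coefficients.\<close>

lemma step_fun_le_iff:
  assumes "well_sampled z"
  shows "(\<forall>i. step_fun K t a (fst (z i)) \<le> snd (z i)) \<longleftrightarrow> (\<forall>j\<in>{1..K}. a j \<le> mle_coeff t z j)"
proof safe
  fix j assume j: "j \<in> {1..K}" and le: "\<forall>i. step_fun K t a (fst (z i)) \<le> snd (z i)"
  obtain i where i: "fst (z i) \<in> cell j" "\<And>k. fst (z k) \<in> cell j \<Longrightarrow> snd (z i) \<le> snd (z k)"
    using assms j unfolding well_sampled_def by blast
  have "mle_coeff t z j = snd (z i)" using i by (rule mle_coeff_attained)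
  then show "a j \<le> mle_coeff t z j"
    using le step_fun_cell[OF j i(1)] by metis
next
  fix k assume le: "\<forall>j\<in>{1..K}. a j \<le> mle_coeff t z j"
  have "fst (z k) \<in> {0..<1}" using assms unfolding well_sampled_def by blast
  then obtain j where j: "j \<in> {1..K}" "fst (z k) \<in> cell j"
    using ex_cell[of "fst (z k)"] unfolding atLeastLessThan_iff by blast
  obtain i where i: "fst (z i) \<in> cell j" "\<And>k. fst (z k) \<in> cell j \<Longrightarrow> snd (z i) \<le> snd (z k)"
    using assms j unfolding well_sampled_def by blast
  have "a j \<le> mle_coeff t z j" using le j by blast
  also have "\<dots> = snd (z i)" using i by (rule mle_coeff_attained)
  also have "\<dots> \<le> snd (z k)" by (rule i(2)) fact
  finally show "step_fun K t a (fst (z k)) \<le> snd (z k)" using step_fun_cell[OF j] by simp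
qed

end

text \<open>In \<open>a = A - b / m\<close> the likelihood \<open>exp (m a) 1(a \<le> A)\<close> of one cell is proportional to the
  exponential density of \<open>b\<close>.\<close>

lemma likelihood_factor_eq:
  fixes m A a :: real
  assumes "0 < m" "G \<noteq> 0"
  shows "exp (m * a) * of_bool (a \<le> A) * g
    = (exp (m * A) * G / m) * (exponential_density m (A - a) * (g / G))"
  using assms by (auto simp: exponential_density_def field_simps exp_diff exp_minus simp flip: exp_add)

locale sampled_grid = grid +
  fixes n :: nat and g :: "real \<Rightarrow> real" and z :: "nat \<Rightarrow> real \<times> real"
  assumes n_pos: "0 < n" and g_measurable [measurable]: "g \<in> borel_measurable borel"
    and g_pos: "\<And>x. 0 < g x" and well_sampled: "well_sampled z"
begin

abbreviation "A \<equiv> mle_coeff t z"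
abbreviation "m \<equiv> \<lambda>j. real n * width j"
abbreviation "Q \<equiv> exp_product K m A"

lemma m_pos: "j \<in> {1..K} \<Longrightarrow> 0 < m j"
  using width_pos n_pos by simp

text \<open>Up to a constant, the density of the posterior with respect to the flat-prior posterior
  \<open>Q\<close>.\<close>

definition prior_ratio :: "(nat \<Rightarrow> real) \<Rightarrow> real" where
  "prior_ratio a = (\<Prod>j=1..K. g (a j) / g (A j))"

text \<open>The factor of the posterior weight that is free of \<open>a\<close>: likelihood and
  prior at the MLE, divided by the rates that normalise the exponential densities. It cancels in
  Bayes' formula.\<close>

definition peak :: real where
  "peak = (\<Prod>j=1..K. exp (m j * A j) * g (A j) / m j)"

lemma peak_pos: "0 < peak"
proof -
  have "0 < exp (m j * A j) * g (A j) / m j" if "j \<in> {1..K}" for j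
    using m_pos[OF that] g_pos[of "A j"] by simp
  then show ?thesis unfolding peak_def by (intro prod_pos)
qed

lemma prior_ratio_nonneg: "0 \<le> prior_ratio a"
  unfolding prior_ratio_def using g_pos by (intro prod_nonneg ballI divide_nonneg_nonneg) (auto intro: less_imp_le)

lemma prior_ratio_measurable [measurable]: "prior_ratio \<in> borel_measurable (param_space K)"
  unfolding prior_ratio_def by measurable

lemma post_weight_eq:
  "post_weight n K t g z a = peak * ((\<Prod>j=1..K. exponential_density (m j) (A j - a j)) * prior_ratio a)"
proof -
  have "post_weight n K t g z a = exp (\<Sum>j=1..K. m j * a j) * of_bool (\<forall>j\<in>{1..K}. a j \<le> A j) * (\<Prod>j=1..K. g (a j))"
    unfolding post_weight_def theta_step_fun_width step_fun_le_iff[OF well_sampled]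
    by (simp add: sum_distrib_left mult_ac)
  also have "of_bool (\<forall>j\<in>{1..K}. a j \<le> A j) = (\<Prod>j=1..K. of_bool (a j \<le> A j) :: real)"
    by auto
  also have "exp (\<Sum>j=1..K. m j * a j) * (\<Prod>j=1..K. of_bool (a j \<le> A j)) * (\<Prod>j=1..K. g (a j))
      = (\<Prod>j=1..K. exp (m j * a j) * of_bool (a j \<le> A j) * g (a j))"
    by (simp add: exp_sum prod.distrib)
  also have "\<dots> = (\<Prod>j=1..K. (exp (m j * A j) * g (A j) / m j)
      * (exponential_density (m j) (A j - a j) * (g (a j) / g (A j))))"
    using m_pos g_pos by (intro prod.cong refl likelihood_factor_eq) (auto simp: less_imp_neq[symmetric])
  also have "\<dots> = peak * ((\<Prod>j=1..K. exponential_density (m j) (A j - a j)) * prior_ratio a)"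
    by (simp only: prod.distrib peak_def prior_ratio_def)
  finally show ?thesis .
qed

lemma exponential_density_prod_nonneg: "0 \<le> (\<Prod>j=1..K. exponential_density (m j) (A j - a j))"
  using m_pos by (intro prod_nonneg ballI exponential_density_nonneg) auto

lemma nn_integral_post_weight:
  assumes ratio: "integrable Q prior_ratio" and [measurable]: "B \<in> sets (param_space K)"
  shows "(\<integral>\<^sup>+a\<in>B. ennreal (post_weight n K t g z a) \<partial>param_space K)
    = ennreal (peak * (\<integral>a. prior_ratio a * indicator B a \<partial>Q))"
proof -
  let ?q = "\<lambda>a. \<Prod>j=1..K. exponential_density (m j) (A j - a j)"
  have q: "Q = density (param_space K) (\<lambda>a. ennreal (?q a))"
    using exp_product_eq_density[of K m A] m_pos
    by (subst prod_ennreal[symmetric]) (auto simp: exponential_density_nonneg)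
  have "(\<integral>\<^sup>+a\<in>B. ennreal (post_weight n K t g z a) \<partial>param_space K)
      = (\<integral>\<^sup>+a. ennreal peak * (ennreal (?q a) * ennreal (prior_ratio a * indicator B a)) \<partial>param_space K)"
    using peak_pos exponential_density_prod_nonneg prior_ratio_nonneg
    by (intro nn_integral_cong) (simp add: post_weight_eq ennreal_mult' indicator_def)
  also have "\<dots> = ennreal peak * (\<integral>\<^sup>+a. ennreal (?q a) * ennreal (prior_ratio a * indicator B a) \<partial>param_space K)"
    by (rule nn_integral_cmult) measurable
  also have "(\<integral>\<^sup>+a. ennreal (?q a) * ennreal (prior_ratio a * indicator B a) \<partial>param_space K)
      = (\<integral>\<^sup>+a. ennreal (prior_ratio a * indicator B a) \<partial>Q)"
    unfolding q by (rule nn_integral_density[symmetric]) measurable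
  also have "\<dots> = ennreal (\<integral>a. prior_ratio a * indicator B a \<partial>Q)"
    using ratio prior_ratio_nonneg
    by (intro nn_integral_eq_integral integrable_real_mult_indicator) auto
  finally show ?thesis
    using peak_pos by (simp add: ennreal_mult')
qed

lemma measure_posterior:
  assumes ratio: "integrable Q prior_ratio" and [measurable]: "B \<in> sets (param_space K)"
  shows "measure (posterior n K t g z) B
    = (\<integral>a. prior_ratio a * indicator B a \<partial>Q) / (\<integral>a. prior_ratio a \<partial>Q)"
proof -
  let ?b = "\<integral>a. prior_ratio a * indicator B a \<partial>Q" and ?c = "\<integral>a. prior_ratio a \<partial>Q"
  have b: "0 \<le> ?b" and c: "0 \<le> ?c" and bc: "?b \<le> ?c"
    using prior_ratio_nonneg ratio
    by (auto intro!: Bochner_Integration.integral_nonneg integral_mono integrable_real_mult_indicator split: split_indicator)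
  have "(\<integral>\<^sup>+a. ennreal (post_weight n K t g z a) \<partial>param_space K)
      = (\<integral>\<^sup>+a\<in>space (param_space K). ennreal (post_weight n K t g z a) \<partial>param_space K)"
    by (intro nn_integral_cong) auto
  also have "\<dots> = ennreal (peak * (\<integral>a. prior_ratio a * indicator (space (param_space K)) a \<partial>Q))"
    by (rule nn_integral_post_weight) (use ratio in auto)
  also have "(\<integral>a. prior_ratio a * indicator (space (param_space K)) a \<partial>Q) = ?c"
    by (intro Bochner_Integration.integral_cong) auto
  finally have "emeasure (posterior n K t g z) B = ennreal (peak * ?b) / ennreal (peak * ?c)"
    by (subst emeasure_posterior) (auto simp: nn_integral_post_weight[OF ratio])
  then show ?thesis
  proof (cases "?c = 0")
    \<comment> \<open>Here \<open>?b \<le> ?c\<close> makes the numerator vanish too, and both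
      quotients are 0 by the conventions for division.\<close>
    case True
    then show ?thesis using b bc \<open>emeasure _ B = _\<close> by (simp add: measure_def)
  next
    case False
    then show ?thesis
      using b c peak_pos \<open>emeasure _ B = _\<close> by (simp add: measure_def divide_ennreal)
  qed
qed

text \<open>Two comparisons are chained. Replacing the posterior by \<open>Q\<close> costs twice the
  mean deviation of \<open>prior_ratio\<close> from 1. Under \<open>Q\<close> the functional is
  \<open>?\<theta> - ?S / n\<close> with \<open>?S\<close> Gamma distributed, and the same affine
  map sends the normal law with mean and variance \<open>K\<close> to the limit law, so it remains
  to compare Gamma and normal on the preimage \<open>?B'\<close>.\<close>

lemma tv_marginal_posterior_le:
  fixes \<beta> C \<delta> :: real
  assumes \<beta>: "0 < \<beta>" "\<beta> \<le> 1" and C: "0 \<le> C"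
    and holder: "\<And>x y. \<bar>g x - g y\<bar> \<le> C * \<bar>x - y\<bar> powr \<beta>"
    and \<delta>: "\<And>j. j \<in> {1..K} \<Longrightarrow> 2 * C / g (A j) * m j powr - \<beta> \<le> \<delta>"
    and B [measurable]: "B \<in> sets borel"
  shows "\<bar>measure (marginal_posterior n K t g z) B
      - measure (normal_law (theta_mle K t z - real K / real n) (real K / (real n)\<^sup>2)) B\<bar>
    \<le> 2 * (exp (real K * \<delta>) - 1) + erlang_normal_dist K"
proof -
  let ?\<theta> = "theta_mle K t z"
  interpret Q: prob_space Q by (rule prob_space_exp_product) (rule m_pos)
  have ratio: "integrable Q prior_ratio"
      and dev: "(\<integral>a. \<bar>prior_ratio a - 1\<bar> \<partial>Q) \<le> exp (real K * \<delta>) - 1"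
    unfolding prior_ratio_def
    using exp_product_holder_ratio[of K m \<beta> g C A \<delta>] m_pos \<beta> g_pos C holder \<delta> by auto
  let ?S = "\<lambda>a. \<Sum>j=1..K. m j * (A j - a j)"
  let ?T = "\<lambda>a. theta (step_fun K t a)" and ?B' = "(\<lambda>s. ?\<theta> - s / n) -` B"
  have T: "?T a = ?\<theta> - ?S a / n" for a
    using n_pos
    by (simp add: theta_mle_def theta_step_fun_width sum_divide_distrib sum_subtractf[symmetric])
       (simp add: algebra_simps)
  have [measurable]: "?T \<in> borel_measurable (param_space K)"
    unfolding theta_step_fun_width by measurable
  have [measurable]: "?B' \<in> sets borel"
    by (rule measurable_sets_borel[OF _ B]) simp
  define B1 where "B1 = ?T -` B \<inter> space (param_space K)"
  have [measurable]: "B1 \<in> sets (param_space K)"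
    unfolding B1_def by measurable
  have "measure (marginal_posterior n K t g z) B = measure (posterior n K t g z) B1"
    unfolding marginal_posterior_def B1_def
    by (subst measure_distr) (auto simp: posterior_def space_PiM)
  also have "\<dots> = (\<integral>a. prior_ratio a * indicator B1 a \<partial>Q) / (\<integral>a. prior_ratio a \<partial>Q)"
    by (rule measure_posterior) (use ratio in auto)
  finally have post: "\<bar>measure (marginal_posterior n K t g z) B - Q.prob B1\<bar> \<le> 2 * (exp (real K * \<delta>) - 1)"
    using Q.normalized_density_diff[OF ratio _ _ dev, of B1] prior_ratio_nonneg by simp
  have D: "distributed Q lborel ?S (erlang_density (K - 1) 1)"
    using exp_product_sum_distributed[of K m A] m_pos K_ge_1 by simp
  have "Q.prob B1 = measure (distr Q lborel ?S) ?B'"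
    using distributed_measurable[OF D]
    by (subst measure_distr) (auto simp: B1_def T intro!: arg_cong[where f = Q.prob])
  also have "distr Q lborel ?S = density lborel (erlang_density (K - 1) 1)"
    using D by (simp add: distributed_def)
  finally have erl: "Q.prob B1 = measure (density lborel (erlang_density (K - 1) 1)) ?B'" .
  let ?N = "density lborel (normal_density K (sqrt K))"
  interpret N: prob_space ?N using K_ge_1 by (intro prob_space_normal_density) simp
  have "distributed ?N lborel (\<lambda>x. x) (normal_density K (sqrt K))"
    by (simp add: distributed_def distr_id2)
  from N.normal_density_affine[OF this, of "- 1 / n" ?\<theta>]
  have "distributed ?N lborel (\<lambda>s. ?\<theta> - s / n) (normal_density (?\<theta> - K / n) (sqrt (K / n\<^sup>2)))"
    using K_ge_1 n_pos by (simp add: real_sqrt_divide)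
  then have "normal_law (?\<theta> - K / n) (K / n\<^sup>2) = distr ?N lborel (\<lambda>s. ?\<theta> - s / n)"
    by (simp add: normal_law_def distributed_def)
  then have "measure (normal_law (?\<theta> - K / n) (K / n\<^sup>2)) B = measure ?N ?B'"
    by (simp add: measure_distr)
  then show ?thesis
    using post erl erlang_normal_measure_diff[OF K_ge_1, of ?B'] by simp
qed

end

section \<open>Cell minima of the Poisson process\<close>

lemma point_count_eq_0_iff: "point_count z B = 0 \<longleftrightarrow> (\<forall>i. z i \<notin> B)"
  by (simp add: point_count_def emeasure_count_space_eq_0)

lemma finite_if_point_count_eq_of_nat:
  assumes "point_count z B = of_nat k"
  shows "finite {i. z i \<in> B}"
proof (rule ccontr)
  assume "infinite {i. z i \<in> B}"
  then have "point_count z B = \<infinity>" by (simp add: point_count_def)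
  with assms show False by (simp add: ennreal_of_nat_eq_real_of_nat)
qed

locale poisson_model = grid +
  fixes n :: nat and a\<^sub>0 :: "nat \<Rightarrow> real" and M :: "'w measure" and Z :: "nat \<Rightarrow> 'w \<Rightarrow> real \<times> real"
  assumes n_pos: "0 < n" and ppp: "poisson_point_process M Z (intensity n (step_fun K t a\<^sub>0))"
begin

sublocale prob_space M
  using ppp by (simp add: poisson_point_process_def)

abbreviation "f\<^sub>0 \<equiv> step_fun K t a\<^sub>0"
abbreviation "\<mu> \<equiv> intensity n f\<^sub>0"

lemma f\<^sub>0_measurable [measurable]: "f\<^sub>0 \<in> borel_measurable borel"
  unfolding step_fun_def by measurable

lemma fst_snd_measurable [measurable]:
  "(fst :: real \<times> real \<Rightarrow> real) \<in> borel_measurable borel"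
  "(snd :: real \<times> real \<Rightarrow> real) \<in> borel_measurable borel"
  by (intro borel_measurable_continuous_onI continuous_intros)+

lemma sets_intensity: "sets \<mu> = sets (restrict_space borel ({0..1} \<times> UNIV))"
  unfolding intensity_def by (simp cong: sets_restrict_space_cong)

lemma Times_in_sets_intensity:
  assumes "A \<in> sets borel" "B \<in> sets borel" "A \<subseteq> {0..1}"
  shows "A \<times> B \<in> sets \<mu>"
proof -
  have "A \<times> B \<in> sets borel" "{0..1::real} \<times> (UNIV :: real set) \<in> sets borel"
    using assms by (auto simp flip: borel_prod)
  then show ?thesis
    unfolding sets_intensity using assms by (auto simp: sets_restrict_space_iff)
qed

lemma emeasure_intensity:
  assumes [measurable]: "B \<in> sets \<mu>"
  shows "emeasure \<mu> B = of_nat n * emeasure lborel {p \<in> B. f\<^sub>0 (fst p) \<le> snd p}"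
proof -
  let ?S = "{0..1::real} \<times> (UNIV :: real set)"
  have S [measurable]: "?S \<in> sets borel" by (auto simp flip: borel_prod)
  have B: "B \<in> sets borel" "B \<subseteq> ?S"
    using assms S unfolding sets_intensity by (auto simp: sets_restrict_space_iff)
  note [measurable] = B(1)
  have [measurable]: "(\<lambda>(x, y). ennreal (of_nat n * of_bool (f\<^sub>0 x \<le> y))) \<in> borel_measurable borel"
    unfolding case_prod_beta by measurable
  have "emeasure \<mu> B
      = (\<integral>\<^sup>+p. (case p of (x, y) \<Rightarrow> ennreal (of_nat n * of_bool (f\<^sub>0 x \<le> y))) * indicator B p \<partial>restrict_space lborel ?S)"
    using assms unfolding intensity_def
    by (intro emeasure_density) (auto intro: measurable_restrict_space1)
  also have "\<dots> = (\<integral>\<^sup>+p. (case p of (x, y) \<Rightarrow> ennreal (of_nat n * of_bool (f\<^sub>0 x \<le> y))) * indicator B p * indicator ?S p \<partial>lborel)"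
    by (subst nn_integral_restrict_space) auto
  also have "\<dots> = (\<integral>\<^sup>+p. of_nat n * indicator {p \<in> B. f\<^sub>0 (fst p) \<le> snd p} p \<partial>lborel)"
    using B(2) by (intro nn_integral_cong) (auto simp: indicator_def ennreal_of_nat_eq_real_of_nat)
  also have "\<dots> = of_nat n * emeasure lborel {p \<in> B. f\<^sub>0 (fst p) \<le> snd p}"
    by (rule nn_integral_cmult_indicator) measurable
  finally show ?thesis .
qed

lemma cell_measurable [measurable]: "cell j \<in> sets borel"
  by (simp add: cell_def)

lemma cell_strip_in_sets: "j \<in> {1..K} \<Longrightarrow> B \<in> sets borel \<Longrightarrow> cell j \<times> B \<in> sets \<mu>"
  using cell_subset[of j] by (intro Times_in_sets_intensity) auto

lemma emeasure_intensity_cell: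
  assumes "j \<in> {1..K}"
  shows "emeasure \<mu> (cell j \<times> {..c}) = ennreal (n * width j * max 0 (c - a\<^sub>0 j))"
proof -
  have "{p \<in> cell j \<times> {..c}. f\<^sub>0 (fst p) \<le> snd p} = cell j \<times> {a\<^sub>0 j..c}"
    using step_fun_cell[OF assms] by (auto simp: mem_Times_iff)
  then have "emeasure \<mu> (cell j \<times> {..c}) = of_nat n * emeasure (lborel \<Otimes>\<^sub>M lborel) (cell j \<times> {a\<^sub>0 j..c})"
    using cell_strip_in_sets[OF assms] by (simp add: emeasure_intensity lborel_prod)
  also have "emeasure (lborel \<Otimes>\<^sub>M lborel) (cell j \<times> {a\<^sub>0 j..c}) = emeasure lborel (cell j) * emeasure lborel {a\<^sub>0 j..c}"
    by (rule lborel.emeasure_pair_measure_Times) auto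
  also have "emeasure lborel (cell j) = ennreal (width j)"
    using width_pos[OF assms] by (simp add: cell_def width_def)
  also have "emeasure lborel {a\<^sub>0 j..c} = ennreal (max 0 (c - a\<^sub>0 j))"
    by (cases "a\<^sub>0 j \<le> c") auto
  finally show ?thesis
    using width_pos[OF assms] by (simp add: ennreal_mult ennreal_of_nat_eq_real_of_nat mult.assoc)
qed

lemma emeasure_intensity_strip:
  assumes j: "j \<in> {1..K}"
  shows "emeasure \<mu> (cell j \<times> UNIV) = \<infinity>"
proof (rule ccontr)
  assume "emeasure \<mu> (cell j \<times> UNIV) \<noteq> \<infinity>"
  then obtain r where r: "0 \<le> r" "emeasure \<mu> (cell j \<times> UNIV) = ennreal r"
    by (cases "emeasure \<mu> (cell j \<times> UNIV)") auto
  define w where "w = n * width j"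
  have w: "0 < w" using width_pos[OF j] n_pos by (simp add: w_def)
  \<comment> \<open>The level is chosen so that the strip below it has mass \<open>r + w\<close>,
    more than the supposed total mass \<open>r\<close>.\<close>
  have "emeasure \<mu> (cell j \<times> {..a\<^sub>0 j + (r / w + 1)}) \<le> emeasure \<mu> (cell j \<times> UNIV)"
    using cell_strip_in_sets[OF j] by (intro emeasure_mono) auto
  then have "w * (r / w + 1) \<le> r"
    using r w by (simp add: emeasure_intensity_cell[OF j, folded w_def] max_def)
  then show False using w by (simp add: distrib_left)
qed

text \<open>Measurability of the counts is contained in the independence clause of the Poisson
  process, applied to a family with a single member.\<close>

lemma point_count_measurable [measurable]:
  assumes "B \<in> sets \<mu>"
  shows "(\<lambda>\<omega>. point_count (\<lambda>i. Z i \<omega>) B) \<in> borel_measurable M"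
proof -
  have "indep_vars (\<lambda>_. borel) (\<lambda>j \<omega>. point_count (\<lambda>i. Z i \<omega>) ((\<lambda>_::nat. B) j)) {..<1}"
    using ppp assms unfolding poisson_point_process_def
    by (elim conjE allE[of _ 1] allE[of _ "\<lambda>_. B"]) (auto simp: disjoint_family_on_def)
  then show ?thesis by (simp add: indep_vars_def)
qed

lemma prob_point_count:
  assumes "B \<in> sets \<mu>" "emeasure \<mu> B < \<infinity>"
  shows "prob {\<omega>\<in>space M. point_count (\<lambda>i. Z i \<omega>) B = of_nat k} = exp (- measure \<mu> B) * measure \<mu> B ^ k / fact k"
  using ppp assms unfolding poisson_point_process_def by blast

lemma prob_point_count_0:
  assumes "B \<in> sets \<mu>" "emeasure \<mu> B = ennreal r" "0 \<le> r"
  shows "prob {\<omega>\<in>space M. point_count (\<lambda>i. Z i \<omega>) B = 0} = exp (- r)"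
  using prob_point_count[OF assms(1), of 0] assms(2,3) by (simp add: measure_def)

text \<open>The Poisson weights sum to one, so the count is almost surely a natural number rather
  than infinite.\<close>

lemma AE_finite_points:
  assumes B: "B \<in> sets \<mu>" "emeasure \<mu> B < \<infinity>"
  shows "AE \<omega> in M. finite {i. Z i \<omega> \<in> B}"
proof -
  define E where "E k = {\<omega>\<in>space M. point_count (\<lambda>i. Z i \<omega>) B = of_nat k}" for k
  have E [measurable]: "E k \<in> events" for k
    unfolding E_def using point_count_measurable[OF B(1)] by measurable
  have "disjoint_family E" by (auto simp: disjoint_family_on_def E_def)
  then have "(\<lambda>k. prob (E k)) sums prob (\<Union>k. E k)"
    by (intro finite_measure_UNION) auto
  moreover have "(\<lambda>k. prob (E k)) sums 1"
  proof -
    have "(\<lambda>k. exp (- measure \<mu> B) * (measure \<mu> B ^ k /\<^sub>R fact k)) sums (exp (- measure \<mu> B) * exp (measure \<mu> B))"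
      by (intro sums_mult exp_converges)
    then show ?thesis
      by (simp add: E_def prob_point_count[OF B] divide_inverse mult_ac flip: exp_add)
  qed
  ultimately have "prob (\<Union>k. E k) = 1" by (rule sums_unique2)
  then have "AE \<omega> in M. \<omega> \<in> (\<Union>k. E k)" by (subst AE_in_set_eq_1) auto
  then show ?thesis
    by eventually_elim (auto simp: E_def dest: finite_if_point_count_eq_of_nat)
qed

lemma Z_measurable [measurable]:
  "(\<lambda>\<omega>. fst (Z i \<omega>)) \<in> borel_measurable M" "(\<lambda>\<omega>. snd (Z i \<omega>)) \<in> borel_measurable M"
proof -
  have "Z i \<in> measurable M (restrict_space borel ({0..1} \<times> UNIV))"
    using ppp measurable_cong_sets[OF refl sets_intensity] by (auto simp: poisson_point_process_def)
  then have [measurable]: "Z i \<in> borel_measurable M"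
    by (simp add: measurable_restrict_space2_iff)
  show "(\<lambda>\<omega>. fst (Z i \<omega>)) \<in> borel_measurable M" "(\<lambda>\<omega>. snd (Z i \<omega>)) \<in> borel_measurable M"
    by measurable
qed

lemma Z_in_space:
  assumes "\<omega> \<in> space M"
  shows "fst (Z i \<omega>) \<in> {0..1}"
proof -
  have "Z i \<in> measurable M \<mu>" using ppp by (simp add: poisson_point_process_def)
  then have "Z i \<omega> \<in> space \<mu>" using assms by (rule measurable_space)
  then show ?thesis by (simp add: intensity_def space_restrict_space mem_Times_iff)
qed

text \<open>The process lives on the closed interval while the cells are half-open; the vertical
  line over 1 is a null set of the intensity and hence almost surely empty.\<close>

lemma AE_fst_less_1: "AE \<omega> in M. \<forall>i. fst (Z i \<omega>) \<in> {0..<1}"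
proof -
  have B: "{1} \<times> UNIV \<in> sets \<mu>" by (intro Times_in_sets_intensity) auto
  have "emeasure lborel ({1::real} \<times> (UNIV :: real set)) = 0"
    by (simp add: lborel.emeasure_pair_measure_Times flip: lborel_prod)
  then have "emeasure lborel {p \<in> {1} \<times> UNIV. f\<^sub>0 (fst p) \<le> snd p} = 0"
    by (rule emeasure_eq_0[rotated]) (auto simp flip: borel_prod)
  then have "emeasure \<mu> ({1} \<times> UNIV) = ennreal 0"
    by (simp add: emeasure_intensity[OF B])
  then have 1: "prob {\<omega>\<in>space M. point_count (\<lambda>i. Z i \<omega>) ({1} \<times> UNIV) = 0} = 1"
    using prob_point_count_0[OF B] by simp
  note [measurable] = point_count_measurable[OF B]
  have "{\<omega>\<in>space M. point_count (\<lambda>i. Z i \<omega>) ({1} \<times> UNIV) = 0} \<in> events" by measurable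
  from prob_Collect_eq_1[OF this] 1
  have "AE \<omega> in M. point_count (\<lambda>i. Z i \<omega>) ({1} \<times> UNIV) = 0" by simp
  then show ?thesis
  proof (rule AE_mp, intro AE_I2 impI allI)
    fix \<omega> i assume "\<omega> \<in> space M" and "point_count (\<lambda>i. Z i \<omega>) ({1} \<times> UNIV) = 0"
    then show "fst (Z i \<omega>) \<in> {0..<1}"
      using Z_in_space[of \<omega> i] by (auto simp: point_count_eq_0_iff mem_Times_iff order_le_less)
  qed
qed

text \<open>Some level \<open>c\<close> lies above a known point of the cell. Only finitely many
  points of the cell are below \<open>c\<close>, and the lowest of them is also below all points
  above \<open>c\<close>.\<close>

lemma ex_min_point:
  fixes z :: "nat \<Rightarrow> real \<times> real"
  assumes fin: "\<And>c::nat. finite {i. z i \<in> cell j \<times> {..real c}}" and i: "z i \<in> cell j \<times> UNIV"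
  shows "\<exists>i. fst (z i) \<in> cell j \<and> (\<forall>k. fst (z k) \<in> cell j \<longrightarrow> snd (z i) \<le> snd (z k))"
proof -
  obtain c :: nat where c: "snd (z i) \<le> real c" using real_arch_simple by blast
  let ?S = "{i. z i \<in> cell j \<times> {..real c}}"
  define k where "k = arg_min_on (\<lambda>i. snd (z i)) ?S"
  have "?S \<noteq> {}" using i c by (auto simp: mem_Times_iff)
  from arg_min_if_finite[OF fin[of c] this, of "\<lambda>i. snd (z i)", folded k_def]
  have k: "k \<in> ?S" "\<And>l. l \<in> ?S \<Longrightarrow> snd (z k) \<le> snd (z l)"
    by (auto simp: not_less)
  have "snd (z k) \<le> snd (z l)" if "fst (z l) \<in> cell j" for l
    using k(1) k(2)[of l] that by (cases "snd (z l) \<le> real c") (auto simp: mem_Times_iff)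
  then show ?thesis using k(1) by (auto simp: mem_Times_iff)
qed

text \<open>The whole strip over a cell has infinite mass, so it contains a point; below each level
  the mass is finite. Natural numbers as levels keep the exceptional null sets countable in
  number.\<close>

lemma AE_well_sampled: "AE \<omega> in M. well_sampled (\<lambda>i. Z i \<omega>)"
proof -
  have "AE \<omega> in M. \<exists>i. fst (Z i \<omega>) \<in> cell j \<and> (\<forall>k. fst (Z k \<omega>) \<in> cell j \<longrightarrow> snd (Z i \<omega>) \<le> snd (Z k \<omega>))"
    if j: "j \<in> {1..K}" for j
  proof -
    have "AE \<omega> in M. \<forall>c::nat. finite {i. Z i \<omega> \<in> cell j \<times> {..real c}}"
      using j by (intro AE_all_countable[THEN iffD2] allI AE_finite_points cell_strip_in_sets)
        (auto simp: emeasure_intensity_cell[OF j])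
    moreover have "AE \<omega> in M. point_count (\<lambda>i. Z i \<omega>) (cell j \<times> UNIV) = \<infinity>"
      using ppp cell_strip_in_sets[OF j, of UNIV] emeasure_intensity_strip[OF j]
      unfolding poisson_point_process_def by auto
    ultimately show ?thesis
    proof eventually_elim
      case (elim \<omega>)
      then have "point_count (\<lambda>i. Z i \<omega>) (cell j \<times> UNIV) \<noteq> 0" by simp
      then obtain i where "Z i \<omega> \<in> cell j \<times> UNIV"
        unfolding point_count_eq_0_iff by metis
      with elim(1) show ?case by (intro ex_min_point[of "\<lambda>i. Z i \<omega>"]) auto
    qed
  qed
  then have "AE \<omega> in M. \<forall>j\<in>{1..K}. \<exists>i. fst (Z i \<omega>) \<in> cell j \<and>
      (\<forall>k. fst (Z k \<omega>) \<in> cell j \<longrightarrow> snd (Z i \<omega>) \<le> snd (Z k \<omega>))"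
    by (intro AE_finite_allI) auto
  with AE_fst_less_1 show ?thesis
    unfolding well_sampled_def by eventually_elim auto
qed

section \<open>The joint law of the cell minima\<close>

abbreviation "mle j \<omega> \<equiv> mle_coeff t (\<lambda>i. Z i \<omega>) j"

text \<open>If no minimum exists then \<open>LEAST\<close> returns a value that does not depend on the points, so
  that the estimator is measurable on the whole space and not only almost surely.\<close>

lemma mle_measurable [measurable]: "mle j \<in> borel_measurable M"
proof -
  define att where "att \<omega> \<longleftrightarrow> (\<exists>i. fst (Z i \<omega>) \<in> cell j \<and>
    (\<forall>k. fst (Z k \<omega>) \<in> cell j \<longrightarrow> snd (Z i \<omega>) \<le> snd (Z k \<omega>)))" for \<omega>
  define d :: real where "d = (THE y. False)"
  have att: "mle j \<omega> \<le> c \<longleftrightarrow> (\<exists>i. fst (Z i \<omega>) \<in> cell j \<and> snd (Z i \<omega>) \<le> c)" if a: "att \<omega>" for \<omega> c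
  proof -
    obtain i where i: "fst (Z i \<omega>) \<in> cell j" "\<And>k. fst (Z k \<omega>) \<in> cell j \<Longrightarrow> snd (Z i \<omega>) \<le> snd (Z k \<omega>)"
      using a unfolding att_def by blast
    have "mle j \<omega> = snd (Z i \<omega>)" using i by (rule mle_coeff_attained[of "\<lambda>i. Z i \<omega>"])
    then show ?thesis using i order_trans by auto
  qed
  have not_att: "mle j \<omega> = d" if "\<not> att \<omega>" for \<omega>
  proof -
    have "\<not> ((\<exists>i. fst (Z i \<omega>) \<in> cell j \<and> snd (Z i \<omega>) = y) \<and>
        (\<forall>y'. (\<exists>i. fst (Z i \<omega>) \<in> cell j \<and> snd (Z i \<omega>) = y') \<longrightarrow> y \<le> y'))" for y
      using that unfolding att_def by blast
    then show ?thesis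
      unfolding mle_coeff_def Least_def d_def cell_def[symmetric] by (intro arg_cong[where f = The] ext) blast
  qed
  have [measurable]: "Measurable.pred M att"
    unfolding att_def by measurable
  have "{\<omega>\<in>space M. mle j \<omega> \<le> c} \<in> events" for c
  proof -
    have "mle j \<omega> \<le> c \<longleftrightarrow> (if att \<omega> then \<exists>i. fst (Z i \<omega>) \<in> cell j \<and> snd (Z i \<omega>) \<le> c else d \<le> c)" for \<omega>
      by (cases "att \<omega>") (simp_all add: att not_att)
    then show ?thesis by (simp only:) measurable
  qed
  then show ?thesis by (rule borel_measurable_iff_le[THEN iffD2, rule_format])
qed

text \<open>Translates tail events of a cell minimum into void events, whose probabilities and
  independence come from the Poisson property.\<close>

lemma mle_greater_iff:
  assumes "well_sampled (\<lambda>i. Z i \<omega>)" "j \<in> {1..K}"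
  shows "c < mle j \<omega> \<longleftrightarrow> point_count (\<lambda>i. Z i \<omega>) (cell j \<times> {..c}) = 0"
proof -
  obtain i where i: "fst (Z i \<omega>) \<in> cell j" "\<And>k. fst (Z k \<omega>) \<in> cell j \<Longrightarrow> snd (Z i \<omega>) \<le> snd (Z k \<omega>)"
    using assms unfolding well_sampled_def by blast
  have "mle j \<omega> = snd (Z i \<omega>)" using i by (rule mle_coeff_attained[of "\<lambda>i. Z i \<omega>"])
  then show ?thesis using i by (force simp: point_count_eq_0_iff mem_Times_iff)
qed

lemma prob_mle_greater:
  assumes j: "j \<in> {1..K}"
  shows "prob {\<omega>\<in>space M. c < mle j \<omega>} = exp (- (n * width j * max 0 (c - a\<^sub>0 j)))"
proof -
  have [measurable]: "cell j \<times> {..c} \<in> sets \<mu>" using j by (intro cell_strip_in_sets) auto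
  have "prob {\<omega>\<in>space M. c < mle j \<omega>} = prob {\<omega>\<in>space M. point_count (\<lambda>i. Z i \<omega>) (cell j \<times> {..c}) = 0}"
  proof (rule finite_measure_eq_AE)
    show "AE \<omega> in M. \<omega> \<in> {\<omega>\<in>space M. c < mle j \<omega>} \<longleftrightarrow> \<omega> \<in> {\<omega>\<in>space M. point_count (\<lambda>i. Z i \<omega>) (cell j \<times> {..c}) = 0}"
      using AE_well_sampled by eventually_elim (simp add: mle_greater_iff[OF _ j])
  qed measurable
  also have "\<dots> = exp (- (n * width j * max 0 (c - a\<^sub>0 j)))"
    using j width_pos[OF j] by (intro prob_point_count_0 emeasure_intensity_cell cell_strip_in_sets) auto
  finally show ?thesis .
qed

text \<open>Independence is checked on the generator of open half-lines. There the events say that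
  strips over distinct cells are void, and these strips are disjoint.\<close>

lemma indep_mle: "indep_vars (\<lambda>_. borel) mle {1..K}"
proof -
  \<comment> \<open>The whole line is added because the generator has to contain the full
    space.\<close>
  define E :: "real set set" where "E = insert UNIV (range greaterThan)"
  have sets: "sets (borel :: real measure) = sigma_sets (space borel) E"
  proof -
    have "sets (borel :: real measure) = sigma_sets UNIV (range greaterThan)"
      by (subst borel_Ioi) simp
    also have "\<dots> = sigma_sets UNIV E"
      unfolding E_def by (rule sigma_sets_eqI) (auto intro: sigma_sets.Basic sigma_sets_top)
    finally show ?thesis by simp
  qed
  have stable: "Int_stable E"
  proof (rule Int_stableI)
    fix a b assume "a \<in> E" "b \<in> E"
    moreover have "{x<..} \<inter> {y<..} = {max x y<..}" for x y :: real by auto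
    ultimately show "a \<inter> b \<in> E" unfolding E_def by auto
  qed
  show ?thesis
  proof (subst indep_vars_finite[where E = "\<lambda>_. E"])
    show "\<forall>A\<in>{1..K} \<rightarrow> E. prob (\<Inter>j\<in>{1..K}. mle j -` A j \<inter> space M) = (\<Prod>j\<in>{1..K}. prob (mle j -` A j \<inter> space M))"
    proof
      fix A assume A: "A \<in> {1..K} \<rightarrow> E"
      define c where "c j = (SOME c. A j = {c<..})" for j
      have c: "A j = {c j<..}" if "j \<in> {1..K}" "A j \<noteq> UNIV" for j
      proof -
        have "\<exists>c. A j = {c<..}" using A that by (auto simp: E_def Pi_def)
        then show ?thesis unfolding c_def by (rule someI_ex)
      qed
      \<comment> \<open>The whole line imposes no constraint and is matched by the empty set, which
        is always void.\<close>
      define B where "B j = (if j \<in> {1..K} \<and> A j \<noteq> UNIV then cell j \<times> {..c j} else {})" for j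
      have B [measurable]: "B j \<in> sets \<mu>" for j
        by (auto simp: B_def intro: cell_strip_in_sets)
      \<comment> \<open>The Poisson definition numbers its sets from 0, so index 0 is filled with
        the empty set and dropped again when independence is used on \<open>{1..K}\<close>.\<close>
      have "disjoint_family_on B {..<K + 1}"
        using cell_unique by (fastforce simp: disjoint_family_on_def B_def)
      moreover have "B ` {..<K + 1} \<subseteq> sets \<mu>" using B by blast
      ultimately have ind: "indep_vars (\<lambda>_. borel) (\<lambda>j \<omega>. point_count (\<lambda>i. Z i \<omega>) (B j)) {..<K + 1}"
        using ppp unfolding poisson_point_process_def by blast
      let ?N = "\<lambda>j. (\<lambda>\<omega>. point_count (\<lambda>i. Z i \<omega>) (B j)) -` {0} \<inter> space M"
      have N [measurable]: "?N j \<in> events" for j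
        by (rule measurable_sets[OF point_count_measurable[OF B]]) simp
      have [measurable]: "A j \<in> sets borel" if "j \<in> {1..K}" for j
        using c[OF that] by (cases "A j = UNIV") auto
      then have mle_events: "mle j -` A j \<inter> space M \<in> events" if "j \<in> {1..K}" for j
        using that by (intro measurable_sets[OF mle_measurable])
      have AE: "AE \<omega> in M. \<forall>j\<in>{1..K}. \<omega> \<in> mle j -` A j \<inter> space M \<longleftrightarrow> \<omega> \<in> ?N j"
        using AE_well_sampled
      proof eventually_elim
        case (elim \<omega>)
        show ?case
        proof
          fix j assume j: "j \<in> {1..K}"
          show "\<omega> \<in> mle j -` A j \<inter> space M \<longleftrightarrow> \<omega> \<in> ?N j"
          proof (cases "A j = UNIV")
            case True
            then show ?thesis by (simp add: B_def point_count_eq_0_iff)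
          next
            case False
            then show ?thesis using c[OF j False] mle_greater_iff[OF elim j, of "c j"] j by (simp add: B_def)
          qed
        qed
      qed
      have ne: "{1..K} \<noteq> {}" using K_ge_1 by simp
      have "prob (\<Inter>j\<in>{1..K}. mle j -` A j \<inter> space M) = prob (\<Inter>j\<in>{1..K}. ?N j)"
      proof (rule finite_measure_eq_AE)
        show "AE \<omega> in M. \<omega> \<in> (\<Inter>j\<in>{1..K}. mle j -` A j \<inter> space M) \<longleftrightarrow> \<omega> \<in> (\<Inter>j\<in>{1..K}. ?N j)"
          using AE by eventually_elim blast
      qed (use ne mle_events N in \<open>auto intro!: sets.finite_INT\<close>)
      also have "\<dots> = (\<Prod>j\<in>{1..K}. prob (?N j))"
        using ne by (intro indep_varsD[OF ind]) auto
      also have "\<dots> = (\<Prod>j\<in>{1..K}. prob (mle j -` A j \<inter> space M))"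
      proof (intro prod.cong refl finite_measure_eq_AE N mle_events)
        fix j assume j: "j \<in> {1..K}"
        show "AE \<omega> in M. \<omega> \<in> ?N j \<longleftrightarrow> \<omega> \<in> mle j -` A j \<inter> space M"
          using AE by eventually_elim (use j in blast)
      qed
      finally show "prob (\<Inter>j\<in>{1..K}. mle j -` A j \<inter> space M) = (\<Prod>j\<in>{1..K}. prob (mle j -` A j \<inter> space M))" .
    qed
  qed (use K_ge_1 sets stable in \<open>auto simp: E_def\<close>)
qed

lemma scaled_le_iff:
  fixes w :: real
  shows "0 < w \<Longrightarrow> w * (x - b) \<le> a \<longleftrightarrow> x \<le> b + a / w"
  by (simp add: field_simps)

text \<open>A strip of height \<open>a / (n * width j)\<close> above the true level has mass
  \<open>a\<close>, so each scaled error has tail \<open>exp (- a)\<close> exactly. By independence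
  the sum of the \<open>K\<close> errors is Gamma distributed for every \<open>n\<close>.\<close>

lemma mle_error_distributed:
  "distributed M lborel (\<lambda>\<omega>. n * (theta_mle K t (\<lambda>i. Z i \<omega>) - theta f\<^sub>0)) (erlang_density (K - 1) 1)"
proof -
  let ?U = "\<lambda>j \<omega>. n * width j * (mle j \<omega> - a\<^sub>0 j)"
  have "indep_vars (\<lambda>_. borel) ?U {1..K}"
    by (rule indep_vars_compose2[OF indep_mle]) auto
  moreover have "distributed M lborel (?U j) (exponential_density 1)" if j: "j \<in> {1..K}" for j
  proof (subst exponential_distributed_iff, simp, intro conjI allI impI)
    fix a :: real assume a: "0 \<le> a"
    have p: "0 < n * width j" using width_pos[OF j] n_pos by simp
    define c where "c = a\<^sub>0 j + a / (n * width j)"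
    have le_iff: "n * width j * (x - a\<^sub>0 j) \<le> a \<longleftrightarrow> x \<le> c" for x
      unfolding c_def using p by (rule scaled_le_iff)
    have "{\<omega>\<in>space M. ?U j \<omega> \<le> a} = space M - {\<omega>\<in>space M. c < mle j \<omega>}"
      unfolding le_iff by (auto simp: not_less)
    then have "prob {\<omega>\<in>space M. ?U j \<omega> \<le> a} = 1 - prob {\<omega>\<in>space M. c < mle j \<omega>}"
      by (simp add: prob_compl)
    also have "max 0 (c - a\<^sub>0 j) = a / (n * width j)"
      unfolding c_def using divide_nonneg_pos[OF a p] by simp
    then have "n * width j * max 0 (c - a\<^sub>0 j) = a"
      using p by (metis less_irrefl nonzero_mult_div_cancel_left times_divide_eq_right)
    then have "prob {\<omega>\<in>space M. c < mle j \<omega>} = exp (- a * 1)"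
      by (simp add: prob_mle_greater[OF j])
    finally show "prob {\<omega>\<in>space M. ?U j \<omega> \<le> a} = 1 - exp (- a * 1)" .
  qed measurable
  ultimately have "distributed M lborel (\<lambda>\<omega>. \<Sum>j\<in>{1..K}. ?U j \<omega>) (erlang_density (card {1..K} - 1) 1)"
    using K_ge_1 by (intro exponential_distributed_sum) auto
  also have "(\<lambda>\<omega>. \<Sum>j\<in>{1..K}. ?U j \<omega>) = (\<lambda>\<omega>. n * (theta_mle K t (\<lambda>i. Z i \<omega>) - theta f\<^sub>0))"
    unfolding theta_mle_def theta_step_fun_width
    by (simp add: sum_distrib_left sum_subtractf[symmetric]) (simp add: algebra_simps)
  finally show ?thesis by simp
qed

text \<open>The event on which all MLE coefficients lie in an interval where the prior density is
  bounded away from 0. The margin 1 above \<open>R\<close> is what makes leaving it exponentially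
  unlikely.\<close>

definition mle_bounded :: "real \<Rightarrow> 'w \<Rightarrow> bool" where
  "mle_bounded R \<omega> \<longleftrightarrow> (\<forall>j\<in>{1..K}. - R \<le> mle j \<omega> \<and> mle j \<omega> \<le> R + 1)"

lemma mle_bounded_measurable [measurable]: "Measurable.pred M (mle_bounded R)"
  unfolding mle_bounded_def by measurable

text \<open>The minima almost surely exceed the true levels, so only the upper end can fail. A union
  bound over the cells uses that each strip between \<open>a\<^sub>0 j\<close> and
  \<open>R + 1\<close> has mass at least \<open>n * h\<close>.\<close>

lemma prob_mle_unbounded:
  fixes h :: real
  assumes a\<^sub>0: "\<And>j. j \<in> {1..K} \<Longrightarrow> \<bar>a\<^sub>0 j\<bar> \<le> R" and h: "\<And>j. j \<in> {1..K} \<Longrightarrow> h \<le> width j"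
  shows "prob {\<omega>\<in>space M. \<not> mle_bounded R \<omega>} \<le> K * exp (- (n * h))"
proof -
  let ?L = "\<lambda>j. {\<omega>\<in>space M. R + 1 < mle j \<omega>}"
  have lower: "AE \<omega> in M. \<forall>j\<in>{1..K}. - R \<le> mle j \<omega>"
  proof (intro AE_finite_allI)
    fix j assume j: "j \<in> {1..K}"
    have "prob {\<omega>\<in>space M. a\<^sub>0 j < mle j \<omega>} = 1"
      by (simp add: prob_mle_greater[OF j])
    then have "AE \<omega> in M. a\<^sub>0 j < mle j \<omega>" by (subst (asm) prob_Collect_eq_1) auto
    then show "AE \<omega> in M. - R \<le> mle j \<omega>"
      by eventually_elim (use a\<^sub>0[OF j] in linarith)
  qed simp
  have "prob {\<omega>\<in>space M. \<not> mle_bounded R \<omega>} \<le> prob (\<Union>j\<in>{1..K}. ?L j)"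
  proof (rule finite_measure_mono_AE[rotated])
    show "AE \<omega> in M. \<omega> \<in> {\<omega>\<in>space M. \<not> mle_bounded R \<omega>} \<longrightarrow> \<omega> \<in> (\<Union>j\<in>{1..K}. ?L j)"
      using AE_space lower by eventually_elim (auto simp: mle_bounded_def not_le)
  qed measurable
  also have "\<dots> \<le> (\<Sum>j\<in>{1..K}. prob (?L j))"
    by (rule finite_measure_subadditive_finite) auto
  also have "\<dots> \<le> (\<Sum>j\<in>{1..K}. exp (- (n * h)))"
  proof (rule sum_mono)
    fix j assume j: "j \<in> {1..K}"
    have "1 \<le> max 0 (R + 1 - a\<^sub>0 j)" using a\<^sub>0[OF j] by linarith
    then have "n * width j * 1 \<le> n * width j * max 0 (R + 1 - a\<^sub>0 j)"
      using width_pos[OF j] by (intro mult_left_mono) auto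
    moreover have "n * h \<le> n * width j"
      using h[OF j] by (intro mult_left_mono) auto
    ultimately have "n * h \<le> n * width j * max 0 (R + 1 - a\<^sub>0 j)"
      by linarith
    then show "prob (?L j) \<le> exp (- (n * h))"
      by (simp add: prob_mle_greater[OF j])
  qed
  finally show ?thesis by simp
qed

text \<open>The posterior weight is jointly measurable in \<open>\<omega>\<close> and
  \<open>a\<close>, so \<open>a\<close> can be integrated out over the sigma-finite parameter space.
  The endpoints depend on \<open>\<omega>\<close>, as those of the credible interval do.\<close>

lemma measure_marginal_posterior_measurable:
  assumes [measurable]: "g \<in> borel_measurable borel" "l \<in> borel_measurable M" "u \<in> borel_measurable M"
  shows "(\<lambda>\<omega>. measure (marginal_posterior n K t g (\<lambda>i. Z i \<omega>)) {l \<omega>..u \<omega>}) \<in> borel_measurable M"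
proof -
  interpret product_sigma_finite "\<lambda>_::nat. lborel :: real measure" ..
  interpret P: sigma_finite_measure "param_space K" by (rule sigma_finite) simp
  let ?T = "\<lambda>a. theta (step_fun K t a)" and ?w = "\<lambda>\<omega> a. ennreal (post_weight n K t g (\<lambda>i. Z i \<omega>) a)"
  let ?I = "\<lambda>\<omega>. {a\<in>space (param_space K). l \<omega> \<le> ?T a \<and> ?T a \<le> u \<omega>}"
  have T [measurable]: "?T \<in> borel_measurable (param_space K)"
    unfolding theta_step_fun_width by measurable
  have sf [measurable]: "(\<lambda>x. step_fun K t (snd x) (fst (Z i (fst x)))) \<in> borel_measurable (M \<Otimes>\<^sub>M param_space K)" for i
    unfolding step_fun_def by measurable
  have w [measurable]: "(\<lambda>x. ?w (fst x) (snd x)) \<in> borel_measurable (M \<Otimes>\<^sub>M param_space K)"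
    unfolding post_weight_def by measurable
  have eq: "measure (marginal_posterior n K t g (\<lambda>i. Z i \<omega>)) {l \<omega>..u \<omega>}
      = enn2real ((\<integral>\<^sup>+a. ?w \<omega> a * of_bool (l \<omega> \<le> ?T a \<and> ?T a \<le> u \<omega>) \<partial>param_space K)
          / (\<integral>\<^sup>+a. ?w \<omega> a \<partial>param_space K))" for \<omega>
  proof -
    have I: "?I \<omega> \<in> sets (param_space K)" by measurable
    have "emeasure (marginal_posterior n K t g (\<lambda>i. Z i \<omega>)) {l \<omega>..u \<omega>}
        = emeasure (posterior n K t g (\<lambda>i. Z i \<omega>)) (?I \<omega>)"
      unfolding marginal_posterior_def
      by (subst emeasure_distr) (auto simp: posterior_def intro!: arg_cong2[where f = emeasure])
    also have "\<dots> = (\<integral>\<^sup>+a\<in>?I \<omega>. ?w \<omega> a \<partial>param_space K) / (\<integral>\<^sup>+a. ?w \<omega> a \<partial>param_space K)"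
      by (rule emeasure_posterior) (use I in auto)
    also have "(\<integral>\<^sup>+a\<in>?I \<omega>. ?w \<omega> a \<partial>param_space K)
        = (\<integral>\<^sup>+a. ?w \<omega> a * of_bool (l \<omega> \<le> ?T a \<and> ?T a \<le> u \<omega>) \<partial>param_space K)"
      by (intro nn_integral_cong) (auto simp: indicator_def)
    finally show ?thesis by (simp add: measure_def)
  qed
  have "(\<lambda>\<omega>. \<integral>\<^sup>+a. ?w \<omega> a * of_bool (l \<omega> \<le> ?T a \<and> ?T a \<le> u \<omega>) \<partial>param_space K) \<in> borel_measurable M"
    by (rule P.borel_measurable_nn_integral) (unfold case_prod_beta, measurable)
  moreover have "(\<lambda>\<omega>. \<integral>\<^sup>+a. ?w \<omega> a \<partial>param_space K) \<in> borel_measurable M"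
    by (rule P.borel_measurable_nn_integral) (unfold case_prod_beta, measurable)
  ultimately show ?thesis unfolding eq by measurable
qed

end

section \<open>Total variation, credibility and coverage\<close>

text \<open>As \<open>inv\<close> is a choice operator, \<open>p\<close> has to be shown to lie in
  the range: the distribution function is continuous, having no atoms, and its limits are 0 and
  1.\<close>

lemma std_normal_cdf_inv:
  assumes "0 < p" "p < 1"
  shows "std_normal_cdf (inv std_normal_cdf p) = p"
proof (rule f_inv_into_f)
  interpret S: real_distribution std_normal_distribution by (rule real_dist_normal_dist)
  have no_atom: "measure std_normal_distribution {x} = 0" for x
    by (simp add: measure_def emeasure_density nn_integral_indicator_singleton)
  have "isCont std_normal_cdf x" for x
    unfolding std_normal_cdf_def S.isCont_cdf by (rule no_atom)
  moreover have "\<forall>\<^sub>F x in at_bot. std_normal_cdf x < p"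
    unfolding std_normal_cdf_def by (rule order_tendstoD(2)[OF S.cdf_lim_at_bot assms(1)])
  then obtain a where a: "\<And>x. x \<le> a \<Longrightarrow> std_normal_cdf x < p"
    by (auto simp: eventually_at_bot_linorder)
  have "\<forall>\<^sub>F x in at_top. p < std_normal_cdf x"
    unfolding std_normal_cdf_def by (rule order_tendstoD(1)[OF S.cdf_lim_at_top_prob assms(2)])
  then obtain b where b: "\<And>x. b \<le> x \<Longrightarrow> p < std_normal_cdf x"
    by (auto simp: eventually_at_top_linorder)
  ultimately have "\<exists>x\<ge>min a b. x \<le> max a b \<and> std_normal_cdf x = p"
    using a[of "min a b"] b[of "max a b"] by (intro IVT) (auto intro: less_imp_le)
  then show "p \<in> range std_normal_cdf" by auto
qed

lemma measure_std_normal_quantiles: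
  assumes "0 < \<alpha>" "\<alpha> < 1"
  shows "measure std_normal_distribution {inv std_normal_cdf (\<alpha> / 2)..inv std_normal_cdf (1 - \<alpha> / 2)} = 1 - \<alpha>"
proof -
  interpret S: real_distribution std_normal_distribution by (rule real_dist_normal_dist)
  let ?p = "inv std_normal_cdf (\<alpha> / 2)" and ?q = "inv std_normal_cdf (1 - \<alpha> / 2)"
  have pq: "std_normal_cdf ?p = \<alpha> / 2" "std_normal_cdf ?q = 1 - \<alpha> / 2"
    by (rule std_normal_cdf_inv; use assms in simp)+
  have "?p < ?q"
  proof (rule ccontr)
    assume "\<not> ?p < ?q"
    then have "std_normal_cdf ?q \<le> std_normal_cdf ?p"
      unfolding std_normal_cdf_def by (intro S.cdf_nondecreasing) simp
    then show False using pq assms by simp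
  qed
  \<comment> \<open>The distribution function measures half-open intervals; the added endpoint is a
    null set.\<close>
  have "measure std_normal_distribution {?p..?q} = measure std_normal_distribution {?p<..?q}"
  proof (rule S.finite_measure_eq_AE)
    have "AE x in lborel. x \<noteq> ?p" by (rule AE_lborel_singleton)
    then show "AE x in std_normal_distribution. x \<in> {?p..?q} \<longleftrightarrow> x \<in> {?p<..?q}"
      by (subst AE_density) auto
  qed auto
  also have "\<dots> = std_normal_cdf ?q - std_normal_cdf ?p"
    using S.cdf_diff_eq[OF \<open>?p < ?q\<close>] by (simp add: std_normal_cdf_def)
  finally show ?thesis using pq by simp
qed

lemma measure_affine_normal:
  assumes "c \<noteq> 0" and [measurable]: "B \<in> sets borel"
  shows "measure (density lborel (normal_density b \<bar>c\<bar>)) B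
    = measure std_normal_distribution {x. b + c * x \<in> B}"
proof -
  interpret S: prob_space std_normal_distribution by (rule prob_space_normal_density) simp
  have "distributed std_normal_distribution lborel (\<lambda>x. x) std_normal_density"
    by (simp add: distributed_def distr_id2)
  from S.normal_density_affine[OF this _ assms(1), of b]
  have "density lborel (normal_density b \<bar>c\<bar>) = distr std_normal_distribution lborel (\<lambda>x. b + c * x)"
    by (simp add: distributed_def)
  then show ?thesis
    by (simp add: measure_distr vimage_def)
qed

text \<open>The map from \<open>\<theta>\<close> to \<open>N * (m - \<theta>)\<close> reverses the
  order, so the two quantiles swap their roles.\<close>

lemma centred_interval_iff:
  fixes N :: real
  assumes "0 < N"
  shows "\<theta> \<in> {m - k / N + s / N * p..m - k / N + s / N * q} \<longleftrightarrow> N * (m - \<theta>) \<in> {k - s * q..k - s * p}"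
proof -
  have eq: "m - k / N + s / N * x = m - (k - s * x) / N" for x
    by (simp add: diff_divide_distrib)
  have "m - u / N \<le> \<theta> \<longleftrightarrow> N * (m - \<theta>) \<le> u" "\<theta> \<le> m - u / N \<longleftrightarrow> u \<le> N * (m - \<theta>)" for u
    using assms by (simp_all add: field_simps)
  then show ?thesis unfolding eq by auto
qed

text \<open>Valid for every configuration: if the normalising constant \<open>?c\<close> is 0 or
  infinite, then \<open>?c / ?c\<close> is 0. This gives the trivial bound on exceptional
  events.\<close>

lemma emeasure_posterior_le_1:
  assumes "g \<in> borel_measurable borel" "B \<in> sets (param_space K)"
  shows "emeasure (posterior n K t g z) B \<le> 1"
proof -
  let ?c = "\<integral>\<^sup>+a. ennreal (post_weight n K t g z a) \<partial>param_space K"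
  have "(\<integral>\<^sup>+a\<in>B. ennreal (post_weight n K t g z a) \<partial>param_space K) \<le> ?c"
    by (intro nn_integral_mono) (auto simp: indicator_def)
  then have "emeasure (posterior n K t g z) B \<le> ?c / ?c"
    unfolding emeasure_posterior[OF assms] by (rule divide_right_mono_ennreal)
  also have "?c / ?c \<le> 1"
    by (cases "?c = 0 \<or> ?c = top") (auto simp: top.not_eq_extremum)
  finally show ?thesis .
qed

lemma measure_marginal_posterior_le_1:
  assumes [measurable]: "g \<in> borel_measurable borel" "B \<in> sets borel"
  shows "measure (marginal_posterior n K t g z) B \<le> 1"
proof -
  have [measurable]: "(\<lambda>a. theta (step_fun K t a)) \<in> borel_measurable (param_space K)"
    unfolding theta_step_fun by measurable
  have "emeasure (marginal_posterior n K t g z) B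
      = emeasure (posterior n K t g z) ((\<lambda>a. theta (step_fun K t a)) -` B \<inter> space (param_space K))"
    unfolding marginal_posterior_def by (subst emeasure_distr) (auto simp: posterior_def)
  also have "\<dots> \<le> 1"
    by (rule emeasure_posterior_le_1) measurable
  finally show ?thesis
    unfolding measure_def using enn2real_mono[of _ 1] by simp
qed

lemma prob_space_normal_law: "0 < v \<Longrightarrow> prob_space (normal_law \<mu> v)"
  unfolding normal_law_def by (rule prob_space_normal_density) simp

lemma abs_diff_measure_le_1:
  fixes p q :: real
  shows "0 \<le> p \<Longrightarrow> p \<le> 1 \<Longrightarrow> 0 \<le> q \<Longrightarrow> q \<le> 1 \<Longrightarrow> \<bar>p - q\<bar> \<le> 1"
  by linarith

text \<open>Collects the constants of the estimates: \<open>C\<close> from the Hoelder condition,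
  \<open>\<gamma>\<close> below the prior density on the compact interval, \<open>h\<close> below
  all widths.\<close>

locale poisson_posterior = poisson_model +
  fixes g :: "real \<Rightarrow> real" and \<beta> C \<gamma> R h :: real
  assumes g_measurable [measurable]: "g \<in> borel_measurable borel"
    and g_pos: "\<And>x. 0 < g x" and \<beta>: "0 < \<beta>" "\<beta> \<le> 1" and C: "0 \<le> C"
    and holder: "\<And>x y. \<bar>g x - g y\<bar> \<le> C * \<bar>x - y\<bar> powr \<beta>"
    and \<gamma>: "0 < \<gamma>" "\<And>x. x \<in> {- R..R + 1} \<Longrightarrow> \<gamma> \<le> g x"
    and a\<^sub>0: "\<And>j. j \<in> {1..K} \<Longrightarrow> \<bar>a\<^sub>0 j\<bar> \<le> R"
    and h: "0 < h" "\<And>j. j \<in> {1..K} \<Longrightarrow> h \<le> width j"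
begin

abbreviation "mpost \<omega> \<equiv> marginal_posterior n K t g (\<lambda>i. Z i \<omega>)"
abbreviation "\<theta>_mle \<omega> \<equiv> theta_mle K t (\<lambda>i. Z i \<omega>)"
abbreviation "limit_law \<omega> \<equiv> normal_law (\<theta>_mle \<omega> - real K / real n) (real K / (real n)\<^sup>2)"

text \<open>The error on the event \<open>mle_bounded R\<close>. It is free of
  \<open>a\<^sub>0\<close>, which later yields uniformity over the class.\<close>

definition tv_bound :: real where
  "tv_bound = 2 * (exp (real K * (2 * C / \<gamma> * (real n * h) powr - \<beta>)) - 1) + erlang_normal_dist K"

lemma tv_bound_ge: "erlang_normal_dist K \<le> tv_bound"
  unfolding tv_bound_def using C \<gamma> by simp

lemma tv_bound_nonneg: "0 \<le> tv_bound"
  using tv_bound_ge erlang_normal_dist_nonneg[of K] by linarith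

lemma \<theta>_mle_measurable [measurable]: "\<theta>_mle \<in> borel_measurable M"
  unfolding theta_mle_def theta_step_fun_width by measurable

lemma prob_space_limit_law: "prob_space (limit_law \<omega>)"
  using K_ge_1 n_pos by (intro prob_space_normal_law) simp

lemma measure_diff_le_1:
  assumes "B \<in> sets borel"
  shows "\<bar>measure (mpost \<omega>) B - measure (limit_law \<omega>) B\<bar> \<le> 1"
  using prob_space.prob_le_1[OF prob_space_limit_law] measure_marginal_posterior_le_1[OF g_measurable assms]
  by (intro abs_diff_measure_le_1) auto

text \<open>Off the event \<open>mle_bounded R\<close> the trivial bound 1 is paid through the
  indicator. One null set serves all \<open>B\<close> at once, so both the supremum over
  \<open>B\<close> and a set depending on \<open>\<omega>\<close> can be inserted.\<close>

lemma AE_measure_diff: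
  "AE \<omega> in M. \<forall>B\<in>sets borel. \<bar>measure (mpost \<omega>) B - measure (limit_law \<omega>) B\<bar>
      \<le> tv_bound + indicator {\<omega>\<in>space M. \<not> mle_bounded R \<omega>} \<omega>"
  using AE_space AE_well_sampled
proof eventually_elim
  case (elim \<omega>)
  show ?case
  proof
    fix B :: "real set" assume B: "B \<in> sets borel"
    show "\<bar>measure (mpost \<omega>) B - measure (limit_law \<omega>) B\<bar> \<le> tv_bound + indicator {\<omega>\<in>space M. \<not> mle_bounded R \<omega>} \<omega>"
    proof (cases "mle_bounded R \<omega>")
      case True
      interpret sampled_grid K t n g "\<lambda>i. Z i \<omega>"
        using n_pos g_measurable g_pos elim by unfold_locales auto
      \<comment> \<open>The lower bounds \<open>\<gamma>\<close> and \<open>h\<close> provide a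
        common \<open>\<delta>\<close> for all cells.\<close>
      have "2 * C / g (mle j \<omega>) * (n * width j) powr - \<beta> \<le> 2 * C / \<gamma> * (n * h) powr - \<beta>"
        if j: "j \<in> {1..K}" for j
      proof (intro mult_mono divide_left_mono powr_mono2' mult_left_mono)
        show "\<gamma> \<le> g (mle j \<omega>)" using \<gamma>(2) True j by (auto simp: mle_bounded_def)
      qed (use C \<gamma> g_pos[of "mle j \<omega>"] \<beta> h n_pos j in auto)
      from tv_marginal_posterior_le[OF \<beta> C holder this B] show ?thesis
        using True by (simp add: tv_bound_def)
    next
      case False
      then show ?thesis
        using measure_diff_le_1[OF B, of \<omega>] tv_bound_nonneg elim by simp
    qed
  qed
qed

lemma expected_tv_le:
  "(\<integral>\<^sup>+\<omega>. ennreal (tv_dist (mpost \<omega>) (limit_law \<omega>)) \<partial>M) \<le> ennreal (tv_bound + K * exp (- (n * h)))"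
proof -
  let ?S = "{\<omega>\<in>space M. \<not> mle_bounded R \<omega>}"
  have "(\<integral>\<^sup>+\<omega>. ennreal (tv_dist (mpost \<omega>) (limit_law \<omega>)) \<partial>M) \<le> (\<integral>\<^sup>+\<omega>. ennreal tv_bound + indicator ?S \<omega> \<partial>M)"
  proof (rule nn_integral_mono_AE)
    show "AE \<omega> in M. ennreal (tv_dist (mpost \<omega>) (limit_law \<omega>)) \<le> ennreal tv_bound + indicator ?S \<omega>"
      using AE_measure_diff
    proof eventually_elim
      case (elim \<omega>)
      then have "tv_dist (mpost \<omega>) (limit_law \<omega>) \<le> tv_bound + indicator ?S \<omega>"
        unfolding tv_dist_def by (intro cSUP_least) auto
      then have "ennreal (tv_dist (mpost \<omega>) (limit_law \<omega>)) \<le> ennreal (tv_bound + indicator ?S \<omega>)"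
        by (rule ennreal_leI)
      also have "\<dots> = ennreal tv_bound + indicator ?S \<omega>"
        using tv_bound_nonneg by (simp add: ennreal_plus ennreal_indicator)
      finally show ?case .
    qed
  qed
  also have "\<dots> = ennreal tv_bound + emeasure M ?S"
    by (subst nn_integral_add) (auto simp: emeasure_space_1)
  also have "\<dots> = ennreal (tv_bound + prob ?S)"
    using tv_bound_nonneg by (simp add: emeasure_eq_measure ennreal_plus)
  also have "\<dots> \<le> ennreal (tv_bound + K * exp (- (n * h)))"
    using prob_mle_unbounded[OF a\<^sub>0 h(2)] by (intro ennreal_leI) simp
  finally show ?thesis .
qed

lemma measure_limit_law_credible_interval:
  assumes \<alpha>: "0 < \<alpha>" "\<alpha> < 1"
  shows "measure (limit_law \<omega>) (credible_interval n K t \<alpha> (\<lambda>i. Z i \<omega>)) = 1 - \<alpha>"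
proof -
  let ?s = "sqrt K / n"
  have s: "0 < ?s" using K_ge_1 n_pos by simp
  have law: "limit_law \<omega> = density lborel (normal_density (\<theta>_mle \<omega> - K / n) \<bar>?s\<bar>)"
    by (simp add: normal_law_def real_sqrt_divide)
  have set: "{x. \<theta>_mle \<omega> - K / n + ?s * x \<in> credible_interval n K t \<alpha> (\<lambda>i. Z i \<omega>)}
      = {inv std_normal_cdf (\<alpha> / 2)..inv std_normal_cdf (1 - \<alpha> / 2)}"
    using s unfolding credible_interval_def by (auto simp del: times_divide_eq_left)
  have "credible_interval n K t \<alpha> (\<lambda>i. Z i \<omega>) \<in> sets borel"
    by (simp add: credible_interval_def)
  then have "measure (limit_law \<omega>) (credible_interval n K t \<alpha> (\<lambda>i. Z i \<omega>))
      = measure std_normal_distribution {x. \<theta>_mle \<omega> - K / n + ?s * x \<in> credible_interval n K t \<alpha> (\<lambda>i. Z i \<omega>)}"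
    unfolding law by (intro measure_affine_normal less_imp_neq[OF s, symmetric])
  then show ?thesis
    unfolding set measure_std_normal_quantiles[OF \<alpha>] .
qed

text \<open>The limit law gives the credible interval mass exactly \<open>1 - \<alpha>\<close> for
  each \<open>\<omega>\<close>, so the total variation estimate can be applied to this random
  interval and integrated.\<close>

lemma expected_credibility:
  assumes \<alpha>: "0 < \<alpha>" "\<alpha> < 1"
  shows "\<bar>(\<integral>\<omega>. measure (mpost \<omega>) (credible_interval n K t \<alpha> (\<lambda>i. Z i \<omega>)) \<partial>M) - (1 - \<alpha>)\<bar>
    \<le> tv_bound + K * exp (- (n * h))"
proof -
  let ?S = "{\<omega>\<in>space M. \<not> mle_bounded R \<omega>}"
  let ?p = "\<lambda>\<omega>. measure (mpost \<omega>) (credible_interval n K t \<alpha> (\<lambda>i. Z i \<omega>))"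
  have [measurable]: "?p \<in> borel_measurable M"
    unfolding credible_interval_def by (intro measure_marginal_posterior_measurable) measurable
  have p: "integrable M ?p"
  proof (rule integrable_const_bound[where B = 1])
    show "AE \<omega> in M. norm (?p \<omega>) \<le> 1"
      using measure_marginal_posterior_le_1[OF g_measurable] by (simp add: credible_interval_def)
  qed fact
  have "(\<integral>\<omega>. ?p \<omega> \<partial>M) - (1 - \<alpha>) = (\<integral>\<omega>. ?p \<omega> - (1 - \<alpha>) \<partial>M)"
    using p by (simp add: prob_space)
  also have "\<bar>\<dots>\<bar> \<le> (\<integral>\<omega>. \<bar>?p \<omega> - (1 - \<alpha>)\<bar> \<partial>M)"
    by (rule integral_abs_bound)
  also have "\<dots> \<le> (\<integral>\<omega>. tv_bound + indicator ?S \<omega> \<partial>M)"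
  proof (rule integral_mono_AE)
    show "AE \<omega> in M. \<bar>?p \<omega> - (1 - \<alpha>)\<bar> \<le> tv_bound + indicator ?S \<omega>"
      using AE_measure_diff
    proof eventually_elim
      case (elim \<omega>)
      have "credible_interval n K t \<alpha> (\<lambda>i. Z i \<omega>) \<in> sets borel" by (simp add: credible_interval_def)
      from bspec[OF elim this] show ?case
        unfolding measure_limit_law_credible_interval[OF \<alpha>] .
    qed
  next
    show "integrable M (\<lambda>\<omega>. \<bar>?p \<omega> - (1 - \<alpha>)\<bar>)"
      using p by (intro integrable_abs Bochner_Integration.integrable_diff) auto
    show "integrable M (\<lambda>\<omega>. tv_bound + indicator ?S \<omega>)"
      by (intro Bochner_Integration.integrable_add integrable_real_indicator) (auto simp: less_top[symmetric])
  qed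
  also have "\<dots> = tv_bound + prob ?S"
    by (subst Bochner_Integration.integral_add) (auto simp: prob_space less_top[symmetric])
  finally show ?thesis using prob_mle_unbounded[OF a\<^sub>0 h(2)] by simp
qed

text \<open>The scaled estimation error has exactly the Gamma law, so the only error is its normal
  approximation on the fixed interval \<open>?J\<close>.\<close>

lemma coverage:
  assumes \<alpha>: "0 < \<alpha>" "\<alpha> < 1"
  shows "\<bar>prob {\<omega>\<in>space M. theta f\<^sub>0 \<in> credible_interval n K t \<alpha> (\<lambda>i. Z i \<omega>)} - (1 - \<alpha>)\<bar> \<le> erlang_normal_dist K"
proof -
  let ?p = "inv std_normal_cdf (\<alpha> / 2)" and ?q = "inv std_normal_cdf (1 - \<alpha> / 2)"
  let ?S = "\<lambda>\<omega>. n * (\<theta>_mle \<omega> - theta f\<^sub>0)"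
  let ?J = "{real K - sqrt K * ?q..real K - sqrt K * ?p}"
  have K: "0 < sqrt K" using K_ge_1 by simp
  have iff: "theta f\<^sub>0 \<in> credible_interval n K t \<alpha> (\<lambda>i. Z i \<omega>) \<longleftrightarrow> ?S \<omega> \<in> ?J" for \<omega>
    unfolding credible_interval_def using n_pos by (intro centred_interval_iff) simp
  have "prob {\<omega>\<in>space M. theta f\<^sub>0 \<in> credible_interval n K t \<alpha> (\<lambda>i. Z i \<omega>)} = measure (distr M lborel ?S) ?J"
    unfolding iff by (subst measure_distr) (auto intro!: arg_cong[where f = prob])
  also have "distr M lborel ?S = density lborel (erlang_density (K - 1) 1)"
    using mle_error_distributed by (simp add: distributed_def)
  finally have 1: "prob {\<omega>\<in>space M. theta f\<^sub>0 \<in> credible_interval n K t \<alpha> (\<lambda>i. Z i \<omega>)}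
    = measure (density lborel (erlang_density (K - 1) 1)) ?J" .
  have "{x. real K + (- sqrt K) * x \<in> ?J} = {?p..?q}"
    using K by auto
  then have "measure (density lborel (normal_density K (sqrt K))) ?J = 1 - \<alpha>"
    using measure_affine_normal[of "- sqrt K" ?J "real K"] K measure_std_normal_quantiles[OF \<alpha>] by simp
  then show ?thesis
    using erlang_normal_measure_diff[OF K_ge_1, of ?J] 1 by simp
qed

end

section \<open>The rate condition and uniformity over the class\<close>

lemma holder_isCont:
  fixes g :: "real \<Rightarrow> real"
  assumes "0 < \<beta>" and holder: "\<And>x y. \<bar>g x - g y\<bar> \<le> C * \<bar>x - y\<bar> powr \<beta>"
  shows "isCont g x"
proof -
  have "((\<lambda>y. C * \<bar>y - x\<bar> powr \<beta>) \<longlongrightarrow> C * \<bar>x - x\<bar> powr \<beta>) (at x)"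
    using assms(1) by (intro tendsto_intros) auto
  then have lim: "((\<lambda>y. C * \<bar>y - x\<bar> powr \<beta>) \<longlongrightarrow> 0) (at x)" by simp
  have "((\<lambda>y. g y - g x) \<longlongrightarrow> 0) (at x)"
    by (rule Lim_null_comparison[OF _ lim]) (simp only: real_norm_def holder eventually_True)
  then show ?thesis by (simp add: isCont_def LIM_zero_iff)
qed

text \<open>With \<open>r\<close> the diverging ratio,
  \<open>n * h = r * K powr (1 / \<beta>) * ln K\<close>. Dropping the logarithm bounds the first
  quantity by \<open>r powr - \<beta>\<close>; dropping the power of \<open>K\<close> gives
  \<open>n * h \<ge> 2 * ln K\<close> and bounds the second by \<open>1 / K\<close>.\<close>

lemma rate_tendsto:
  fixes K :: "nat \<Rightarrow> nat" and h :: "nat \<Rightarrow> real"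
  assumes \<beta>: "0 < \<beta>" "\<beta> \<le> 1"
    and rate: "filterlim (\<lambda>n. real n * h n / (real (K n) powr (1 / \<beta>) * ln (real (K n)))) at_top sequentially"
    and K: "filterlim K at_top sequentially"
  shows "(\<lambda>n. real (K n) * (real n * h n) powr - \<beta>) \<longlonglongrightarrow> 0"
    and "(\<lambda>n. real (K n) * exp (- (real n * h n))) \<longlonglongrightarrow> 0"
    and "\<forall>\<^sub>F n in sequentially. 0 < h n"
proof -
  define r where "r n = real n * h n / (real (K n) powr (1 / \<beta>) * ln (real (K n)))" for n
  have r: "filterlim r at_top sequentially" using rate by (simp add: r_def[abs_def])
  \<comment> \<open>The threshold 3 exceeds Euler's number, so the logarithm is at least 1.\<close>
  have *: "\<forall>\<^sub>F n in sequentially. 2 \<le> r n \<and> 3 \<le> K n \<and> 1 \<le> ln (real (K n)) \<and>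
      real n * h n = r n * real (K n) powr (1 / \<beta>) * ln (real (K n))"
    using filterlim_at_top[THEN iffD1, OF r, rule_format, of 2]
      filterlim_at_top[THEN iffD1, OF K, rule_format, of 3]
  proof eventually_elim
    case (elim n)
    have "exp 1 \<le> real (K n)" using e_less_272 elim by linarith
    then have "ln (exp 1) \<le> ln (real (K n))" using elim by (subst ln_le_cancel_iff) auto
    then have ln: "1 \<le> ln (real (K n))" by simp
    moreover have "real n * h n = r n * real (K n) powr (1 / \<beta>) * ln (real (K n))"
      using elim ln by (simp add: r_def)
    ultimately show ?case using elim by simp
  qed
  show "\<forall>\<^sub>F n in sequentially. 0 < h n"
    using *
  proof eventually_elim
    case (elim n)
    have "0 < r n * real (K n) powr (1 / \<beta>) * ln (real (K n))"
      using elim by (intro mult_pos_pos) auto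
    then have "0 < real n * h n" using elim by simp
    then show ?case by (simp add: zero_less_mult_iff)
  qed
  show "(\<lambda>n. real (K n) * (real n * h n) powr - \<beta>) \<longlonglongrightarrow> 0"
  proof (rule tendsto_sandwich[OF _ _ tendsto_const])
    show "(\<lambda>n. r n powr - \<beta>) \<longlonglongrightarrow> 0" using \<beta> r by (intro tendsto_neg_powr) auto
    show "\<forall>\<^sub>F n in sequentially. real (K n) * (real n * h n) powr - \<beta> \<le> r n powr - \<beta>"
      using *
    proof eventually_elim
      case (elim n)
      let ?k = "real (K n) powr (1 / \<beta>)"
      have k: "0 < r n * ?k" using elim by simp
      then have "r n * ?k * 1 \<le> r n * ?k * ln (real (K n))" using elim by (intro mult_left_mono) auto
      then have "(real n * h n) powr - \<beta> \<le> (r n * ?k) powr - \<beta>"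
        using k \<beta> elim by (intro powr_mono2') auto
      also have "\<dots> = r n powr - \<beta> * real (K n) powr - 1"
        using elim \<beta> by (simp add: powr_mult powr_powr)
      finally have "real (K n) * (real n * h n) powr - \<beta> \<le> real (K n) * (r n powr - \<beta> * real (K n) powr - 1)"
        by (intro mult_left_mono) auto
      also have "\<dots> = r n powr - \<beta>"
        using elim by (simp add: powr_minus)
      finally show ?case .
    qed
  qed (auto intro!: always_eventually)
  show "(\<lambda>n. real (K n) * exp (- (real n * h n))) \<longlonglongrightarrow> 0"
  proof (rule tendsto_sandwich[OF _ _ tendsto_const])
    have "filterlim (\<lambda>n. real (K n)) at_top sequentially"
      by (rule filterlim_compose[OF filterlim_real_sequentially K])
    then show "(\<lambda>n. inverse (real (K n))) \<longlonglongrightarrow> 0" by (rule tendsto_inverse_0_at_top)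
    show "\<forall>\<^sub>F n in sequentially. real (K n) * exp (- (real n * h n)) \<le> inverse (real (K n))"
      using *
    proof eventually_elim
      case (elim n)
      have "1 \<le> real (K n) powr (1 / \<beta>)" using elim \<beta> by (intro ge_one_powr_ge_zero) auto
      then have "2 * 1 \<le> r n * real (K n) powr (1 / \<beta>)" using elim by (intro mult_mono) auto
      then have "2 * ln (real (K n)) \<le> real n * h n"
        using elim by (simp only:) (intro mult_right_mono, auto)
      then have "exp (- (real n * h n)) \<le> exp (- (ln (real (K n)) + ln (real (K n))))" by simp
      also have "\<dots> = inverse (real (K n)) * inverse (real (K n))"
        using elim by (simp only: exp_minus exp_add inverse_mult_distrib) simp
      finally have "real (K n) * exp (- (real n * h n)) \<le> real (K n) * (inverse (real (K n)) * inverse (real (K n)))"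
        by (intro mult_left_mono) auto
      also have "\<dots> = inverse (real (K n))" using elim by simp
      finally show ?case .
    qed
  qed (auto intro!: always_eventually)
qed

text \<open>A real supremum is informative only over a nonempty bounded set; \<open>S\<close>
  supplies the former and \<open>le\<close> the latter, for all large \<open>n\<close>.\<close>

lemma SUP_abs_tendsto_0:
  fixes f :: "nat \<Rightarrow> 'a \<Rightarrow> real"
  assumes e: "e \<longlonglongrightarrow> 0" and S: "\<And>n. S n \<noteq> {}"
    and le: "\<forall>\<^sub>F n in sequentially. \<forall>x\<in>S n. \<bar>f n x\<bar> \<le> e n"
  shows "(\<lambda>n. SUP x\<in>S n. \<bar>f n x\<bar>) \<longlonglongrightarrow> 0"
proof (rule tendsto_sandwich[OF _ _ tendsto_const e])
  show "\<forall>\<^sub>F n in sequentially. (SUP x\<in>S n. \<bar>f n x\<bar>) \<le> e n"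
    using le by eventually_elim (intro cSUP_least S, auto)
  show "\<forall>\<^sub>F n in sequentially. 0 \<le> (SUP x\<in>S n. \<bar>f n x\<bar>)"
    using le
  proof eventually_elim
    case (elim n)
    obtain x where x: "x \<in> S n" using S by blast
    have "\<bar>f n x\<bar> \<le> (SUP x\<in>S n. \<bar>f n x\<bar>)"
      using elim x by (intro cSUP_upper bdd_aboveI[where M = "e n"]) auto
    then show ?case by linarith
  qed
qed

theorem corollary4p2:
  fixes R \<beta> :: real and g :: "real \<Rightarrow> real"
    and K :: "nat \<Rightarrow> nat" and t :: "nat \<Rightarrow> nat \<Rightarrow> real"
    and P :: "nat \<Rightarrow> (real \<Rightarrow> real) \<Rightarrow> 'w measure" and Z :: "nat \<Rightarrow> 'w \<Rightarrow> real \<times> real"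
  assumes "0 < R"
    and "0 < \<beta>" and "\<beta> \<le> 1" and "positive_holder_density \<beta> g"
    and "\<And>n. 1 \<le> n \<Longrightarrow> 1 \<le> K n"
    and "\<And>n. 1 \<le> n \<Longrightarrow> t n 0 = 0 \<and> t n (K n) = 1 \<and> strict_mono_on {0..K n} (t n)"
    and "\<And>n f. 1 \<le> n \<Longrightarrow> f \<in> PC_star (K n) (t n) R \<Longrightarrow>
           poisson_point_process (P n f) Z (intensity n f)"
    and "filterlim (\<lambda>n. real n * (INF j\<in>{1..K n}. \<bar>t n j - t n (j - 1)\<bar>)
                          / (real (K n) powr (1 / \<beta>) * ln (real (K n)))) at_top sequentially"
    and "filterlim K at_top sequentially"
  shows "((\<lambda>n. SUP f\<^sub>0\<in>PC_star (K n) (t n) R.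
             \<integral>\<^sup>+\<omega>. ennreal (tv_dist (marginal_posterior n (K n) (t n) g (\<lambda>i. Z i \<omega>))
                              (normal_law (theta_mle (K n) (t n) (\<lambda>i. Z i \<omega>) - real (K n) / real n)
                                          (real (K n) / (real n)\<^sup>2))) \<partial>P n f\<^sub>0)
           \<longlonglongrightarrow> 0) \<and>
    (\<forall>\<alpha>. 0 < \<alpha> \<and> \<alpha> < 1 \<longrightarrow>
       ((\<lambda>n. SUP f\<^sub>0\<in>PC_star (K n) (t n) R.
          \<bar>(\<integral>\<omega>. measure (marginal_posterior n (K n) (t n) g (\<lambda>i. Z i \<omega>))
                        (credible_interval n (K n) (t n) \<alpha> (\<lambda>i. Z i \<omega>)) \<partial>P n f\<^sub>0) - (1 - \<alpha>)\<bar>)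
        \<longlonglongrightarrow> 0) \<and>
       ((\<lambda>n. SUP f\<^sub>0\<in>PC_star (K n) (t n) R.
          \<bar>measure (P n f\<^sub>0) {\<omega>\<in>space (P n f\<^sub>0).
                theta f\<^sub>0 \<in> credible_interval n (K n) (t n) \<alpha> (\<lambda>i. Z i \<omega>)} - (1 - \<alpha>)\<bar>)
        \<longlonglongrightarrow> 0))"
proof -
  note R = assms(1) and \<beta> = assms(2,3) and g = assms(4) and K_ge_1 = assms(5) and grid = assms(6)
    and ppp = assms(7) and rate = assms(8) and K = assms(9)
  obtain C\<^sub>0 where C\<^sub>0: "\<And>x y. \<bar>g x - g y\<bar> \<le> C\<^sub>0 * \<bar>x - y\<bar> powr \<beta>"
    using g by (auto simp: positive_holder_density_def)
  define C where "C = \<bar>C\<^sub>0\<bar>"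
  have holder: "\<bar>g x - g y\<bar> \<le> C * \<bar>x - y\<bar> powr \<beta>" for x y
    by (rule order_trans[OF C\<^sub>0]) (simp add: C_def mult_right_mono)
  have g': "g \<in> borel_measurable borel" "\<And>x. 0 < g x"
    using g by (auto simp: positive_holder_density_def)
  have "continuous_on {- R..R + 1} g"
    using holder_isCont[OF \<beta>(1) holder] by (intro continuous_at_imp_continuous_on) auto
  moreover have "{- R..R + 1} \<noteq> {}" using R by simp
  \<comment> \<open>The value \<open>g x\<^sub>0\<close> serves as \<open>\<gamma>\<close>; it is
    positive because \<open>g\<close> is.\<close>
  ultimately obtain x\<^sub>0 where x\<^sub>0: "\<And>x. x \<in> {- R..R + 1} \<Longrightarrow> g x\<^sub>0 \<le> g x"
    using continuous_attains_inf[OF compact_Icc] by blast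
  define h where "h n = (INF j\<in>{1..K n}. \<bar>t n j - t n (j - 1)\<bar>)" for n
  define D where "D = 2 * C / g x\<^sub>0"
  \<comment> \<open>The sum of \<open>tv_bound\<close> and the bound for the probability that the
    MLE leaves the compact interval.\<close>
  define e where "e n = 2 * (exp (real (K n) * (2 * C / g x\<^sub>0 * (real n * h n) powr - \<beta>)) - 1)
    + erlang_normal_dist (K n) + real (K n) * exp (- (real n * h n))" for n
  note rates = rate_tendsto[OF \<beta> rate[folded h_def] K]
  have "(\<lambda>n. 2 * (exp (D * (real (K n) * (real n * h n) powr - \<beta>)) - 1)
      + erlang_normal_dist (K n) + real (K n) * exp (- (real n * h n))) \<longlonglongrightarrow> 2 * (exp (D * 0) - 1) + 0 + 0"
    by (intro tendsto_intros rates filterlim_compose[OF erlang_normal_dist_tendsto K])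
  then have e: "e \<longlonglongrightarrow> 0"
    by (simp add: e_def[abs_def] D_def mult_ac)
  \<comment> \<open>The same constants serve every \<open>f\<close> of the class; only the
    coefficient vector \<open>a\<close> varies.\<close>
  have model: "\<exists>a. f = step_fun (K n) (t n) a \<and>
      poisson_posterior (K n) (t n) n a (P n f) Z g \<beta> C (g x\<^sub>0) R (h n)"
    if n: "1 \<le> n" "0 < h n" and f: "f \<in> PC_star (K n) (t n) R" for n f
  proof -
    obtain a where a: "f = step_fun (K n) (t n) a" "\<And>j. j \<in> {1..K n} \<Longrightarrow> \<bar>a j\<bar> \<le> R"
      using f by (auto simp: PC_star_def)
    interpret grid "K n" "t n"
      using K_ge_1[OF n(1)] grid[OF n(1)] by unfold_locales auto
    have "h n \<le> width j" if j: "j \<in> {1..K n}" for j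
    proof -
      have "h n \<le> \<bar>t n j - t n (j - 1)\<bar>"
        unfolding h_def using j by (intro cINF_lower) auto
      then show ?thesis using width_pos[OF j] by (simp add: width_def)
    qed
    then have "poisson_posterior (K n) (t n) n a (P n f) Z g \<beta> C (g x\<^sub>0) R (h n)"
      using n \<beta> g' holder x\<^sub>0 a ppp[OF n(1) f] by unfold_locales (auto simp: C_def)
    then show ?thesis using a by blast
  qed
  have ne: "PC_star (K n) (t n) R \<noteq> {}" for n
    using R by (auto simp: PC_star_def intro!: exI[of _ "\<lambda>_. 0"])
  have ev: "\<forall>\<^sub>F n in sequentially. 1 \<le> n \<and> 0 < h n"
    using rates(3) eventually_ge_at_top[of 1] by eventually_elim simp
  have tv: "(\<lambda>n. SUP f\<^sub>0\<in>PC_star (K n) (t n) R.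
             \<integral>\<^sup>+\<omega>. ennreal (tv_dist (marginal_posterior n (K n) (t n) g (\<lambda>i. Z i \<omega>))
                              (normal_law (theta_mle (K n) (t n) (\<lambda>i. Z i \<omega>) - real (K n) / real n)
                                          (real (K n) / (real n)\<^sup>2))) \<partial>P n f\<^sub>0) \<longlonglongrightarrow> 0"
  proof (rule tendsto_sandwich[OF _ _ tendsto_const])
    show "(\<lambda>n. ennreal (e n)) \<longlonglongrightarrow> 0" using tendsto_ennrealI[OF e] by simp
    show "\<forall>\<^sub>F n in sequentially. (SUP f\<^sub>0\<in>PC_star (K n) (t n) R.
             \<integral>\<^sup>+\<omega>. ennreal (tv_dist (marginal_posterior n (K n) (t n) g (\<lambda>i. Z i \<omega>))
                              (normal_law (theta_mle (K n) (t n) (\<lambda>i. Z i \<omega>) - real (K n) / real n)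
                                          (real (K n) / (real n)\<^sup>2))) \<partial>P n f\<^sub>0) \<le> ennreal (e n)"
      using ev
    proof eventually_elim
      case (elim n)
      show ?case
      proof (rule SUP_least)
        fix f assume "f \<in> PC_star (K n) (t n) R"
        then obtain a where "f = step_fun (K n) (t n) a"
            "poisson_posterior (K n) (t n) n a (P n f) Z g \<beta> C (g x\<^sub>0) R (h n)"
          using model elim by blast
        from poisson_posterior.expected_tv_le[OF this(2)] poisson_posterior.tv_bound_def[OF this(2)]
        show "(\<integral>\<^sup>+\<omega>. ennreal (tv_dist (marginal_posterior n (K n) (t n) g (\<lambda>i. Z i \<omega>))
                              (normal_law (theta_mle (K n) (t n) (\<lambda>i. Z i \<omega>) - real (K n) / real n)
                                          (real (K n) / (real n)\<^sup>2))) \<partial>P n f) \<le> ennreal (e n)"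
          by (simp add: e_def)
      qed
    qed
  qed auto
  show ?thesis
  proof (intro conjI allI impI tv)
    fix \<alpha> :: real assume "0 < \<alpha> \<and> \<alpha> < 1"
    then have \<alpha>: "0 < \<alpha>" "\<alpha> < 1" by auto
    show "(\<lambda>n. SUP f\<^sub>0\<in>PC_star (K n) (t n) R.
          \<bar>(\<integral>\<omega>. measure (marginal_posterior n (K n) (t n) g (\<lambda>i. Z i \<omega>))
                        (credible_interval n (K n) (t n) \<alpha> (\<lambda>i. Z i \<omega>)) \<partial>P n f\<^sub>0) - (1 - \<alpha>)\<bar>) \<longlonglongrightarrow> 0"
    proof (rule SUP_abs_tendsto_0[OF e ne])
      show "\<forall>\<^sub>F n in sequentially. \<forall>f\<in>PC_star (K n) (t n) R.
        \<bar>(\<integral>\<omega>. measure (marginal_posterior n (K n) (t n) g (\<lambda>i. Z i \<omega>))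
                        (credible_interval n (K n) (t n) \<alpha> (\<lambda>i. Z i \<omega>)) \<partial>P n f) - (1 - \<alpha>)\<bar> \<le> e n"
        using ev
      proof eventually_elim
        case (elim n)
        show ?case
        proof
          fix f assume "f \<in> PC_star (K n) (t n) R"
          then obtain a where "f = step_fun (K n) (t n) a"
              "poisson_posterior (K n) (t n) n a (P n f) Z g \<beta> C (g x\<^sub>0) R (h n)"
            using model elim by blast
          from poisson_posterior.expected_credibility[OF this(2) \<alpha>] poisson_posterior.tv_bound_def[OF this(2)]
          show "\<bar>(\<integral>\<omega>. measure (marginal_posterior n (K n) (t n) g (\<lambda>i. Z i \<omega>))
                        (credible_interval n (K n) (t n) \<alpha> (\<lambda>i. Z i \<omega>)) \<partial>P n f) - (1 - \<alpha>)\<bar> \<le> e n"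
            by (simp add: e_def)
        qed
      qed
    qed
    show "(\<lambda>n. SUP f\<^sub>0\<in>PC_star (K n) (t n) R.
          \<bar>measure (P n f\<^sub>0) {\<omega>\<in>space (P n f\<^sub>0).
                theta f\<^sub>0 \<in> credible_interval n (K n) (t n) \<alpha> (\<lambda>i. Z i \<omega>)} - (1 - \<alpha>)\<bar>) \<longlonglongrightarrow> 0"
    proof (rule SUP_abs_tendsto_0[OF filterlim_compose[OF erlang_normal_dist_tendsto K] ne])
      show "\<forall>\<^sub>F n in sequentially. \<forall>f\<in>PC_star (K n) (t n) R.
          \<bar>measure (P n f) {\<omega>\<in>space (P n f).
                theta f \<in> credible_interval n (K n) (t n) \<alpha> (\<lambda>i. Z i \<omega>)} - (1 - \<alpha>)\<bar> \<le> erlang_normal_dist (K n)"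
        using ev
      proof eventually_elim
        case (elim n)
        show ?case
        proof
          fix f assume "f \<in> PC_star (K n) (t n) R"
          then obtain a where f: "f = step_fun (K n) (t n) a"
              "poisson_posterior (K n) (t n) n a (P n f) Z g \<beta> C (g x\<^sub>0) R (h n)"
            using model elim by blast
          from poisson_posterior.coverage[OF f(2) \<alpha>]
          show "\<bar>measure (P n f) {\<omega>\<in>space (P n f).
                theta f \<in> credible_interval n (K n) (t n) \<alpha> (\<lambda>i. Z i \<omega>)} - (1 - \<alpha>)\<bar> \<le> erlang_normal_dist (K n)"
            unfolding f(1)[symmetric] .
        qed
      qed
    qed
  qed
qed

end
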